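(* Let $\mathcal X\subseteq[0,1]$ be a Borel set with $0,1\in\mathcal X$, fix $\mu\in(0,1)$ and let $I_\mu=[(\mu-1)^{-1},\mu^{-1}]$. Let $\mathcal H^\infty_\mu$ be the set of probability measures $P$ on $\mathcal X^\infty$ such that $\mathbb E_P[X_t\mid X^{t-1}]=\mu$ $P$-a.s. for all $t\ge1$ (with $\mathbb E_P[X_1\mid X^0]=\mathbb E_P[X_1]$). Let $\Lambda^\infty_\mu$ be the set of sequences $\lambda^\infty=(\lambda_t)_{t\ge1}$ with each $\lambda_t:\mathcal X^{t-1}\to I_\mu$ Borel ($\lambda_1$ an element of $I_\mu$), and for $\lambda^\infty\in\Lambda^\infty_\mu$ let $E^{\lambda^\infty}=(E^{\lambda^\infty}_T)_{T\ge0}$ with $E^{\lambda^\infty}_0=1$ and $E^{\lambda^\infty}_T(x^T)=\prod_{t=1}^T\big(1+\lambda_t(x^{t-1})(x_t-\mu)\big)$ for $T\ge1$. Then the coin-betting e-process class $\mathcal E^{\mathrm{cb},\infty}_\mu=\{E^{\lambda^\infty}:\lambda^\infty\in\Lambda^\infty_\mu\}$ is the optimal e-process class for $\mathcal H^\infty_\mu$.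
   Context: $\mathcal X^\infty$ is the space of sequences $x^\infty=(x_t)_{t\ge1}$ in $\mathcal X$ with the product sigma-field generated by cylinder sets; $\mathcal F_t$ is the sigma-field generated by the first $t$ coordinates. A finite stopping time is a measurable $\tau:\mathcal X^\infty\to\mathbb N=\{0,1,2,\dots\}$ with $\{\tau=t\}\in\mathcal F_t$ for every $t\ge0$; $\mathcal T$ is the set of finite stopping times. An e-process for $\mathcal H^\infty_\mu$ is a sequence $E=(E_t)_{t\ge0}$ of non-negative Borel functions $E_t:\mathcal X^t\to[0,+\infty)$ ($E_0$ a constant) such that $\mathbb E_P[E_\tau]\le1$ for all $P\in\mathcal H^\infty_\mu$ and all $\tau\in\mathcal T$, where $E_\tau(x^\infty)=E_{\tau(x^\infty)}(x^{\tau(x^\infty)})$. An e-process class is any set of e-processes. $E\succeq E'$ means $E_t(x^t)\ge E'_t(x^t)$ for all $t\ge0$ and all $x^t$; $E\succ E'$ means $E\succeq E'$ and $E\neq E'$. An e-process is maximal if no e-process strictly majorises it. An e-process class $\mathcal E$ is majorising if for every e-process $E$ there is $E'\in\mathcal E$ with $E\preceq E'$, and it is optimal if it is majorising and all its elements are maximal. *)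

theory Defs
  imports "HOL-Probability.Probability"
begin

text \<open>Conventions: a sequence x^\<infinity> is a function nat => real; the paper's coordinate
  x_t (t >= 1) is x (t - 1). A prefix x^t is represented by restrict x {..<t}, an
  element of the finite product space PiM {..<t} (\<lambda>_. Xs).\<close>

definition coord_space :: "real set \<Rightarrow> real measure" where
  "coord_space Xs = restrict_space borel Xs"

definition seq_space :: "real set \<Rightarrow> (nat \<Rightarrow> real) measure" where
  "seq_space Xs = PiM UNIV (\<lambda>_. coord_space Xs)"

definition prefix_space :: "real set \<Rightarrow> nat \<Rightarrow> (nat \<Rightarrow> real) measure" where
  "prefix_space Xs t = PiM {..<t} (\<lambda>_. coord_space Xs)"

definition filt :: "real set \<Rightarrow> (nat \<Rightarrow> real) measure \<Rightarrow> nat \<Rightarrow> (nat \<Rightarrow> real) measure" where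
  "filt Xs M t = vimage_algebra (space M) (\<lambda>x. restrict x {..<t}) (prefix_space Xs t)"

definition finite_stopping_time :: "real set \<Rightarrow> ((nat \<Rightarrow> real) \<Rightarrow> nat) \<Rightarrow> bool" where
  "finite_stopping_time Xs \<tau> \<longleftrightarrow>
     (\<forall>t. {x \<in> space (seq_space Xs). \<tau> x = t} \<in> sets (filt Xs (seq_space Xs) t))"

definition H_mu :: "real set \<Rightarrow> real \<Rightarrow> (nat \<Rightarrow> real) measure set" where
  "H_mu Xs \<mu> = {P. prob_space P \<and> sets P = sets (seq_space Xs) \<and>
     (\<forall>t. AE x in P. real_cond_exp P (filt Xs P t) (\<lambda>y. y t) x = \<mu>)}"

definition stopped :: "(nat \<Rightarrow> (nat \<Rightarrow> real) \<Rightarrow> real) \<Rightarrow> ((nat \<Rightarrow> real) \<Rightarrow> nat) \<Rightarrow> (nat \<Rightarrow> real) \<Rightarrow> real" where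
  "stopped E \<tau> x = E (\<tau> x) (restrict x {..<\<tau> x})"

definition eprocess :: "real set \<Rightarrow> real \<Rightarrow> (nat \<Rightarrow> (nat \<Rightarrow> real) \<Rightarrow> real) \<Rightarrow> bool" where
  "eprocess Xs \<mu> E \<longleftrightarrow>
     (\<forall>t. E t \<in> borel_measurable (prefix_space Xs t)) \<and>
     (\<forall>t. \<forall>x \<in> space (prefix_space Xs t). 0 \<le> E t x) \<and>
     (\<forall>P \<in> H_mu Xs \<mu>. \<forall>\<tau>. finite_stopping_time Xs \<tau> \<longrightarrow>
        (\<integral>\<^sup>+ x. ennreal (stopped E \<tau> x) \<partial>P) \<le> 1)"

definition majorises :: "real set \<Rightarrow> (nat \<Rightarrow> (nat \<Rightarrow> real) \<Rightarrow> real) \<Rightarrow> (nat \<Rightarrow> (nat \<Rightarrow> real) \<Rightarrow> real) \<Rightarrow> bool" where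
  "majorises Xs E E' \<longleftrightarrow> (\<forall>t. \<forall>x \<in> space (prefix_space Xs t). E' t x \<le> E t x)"

definition strictly_majorises :: "real set \<Rightarrow> (nat \<Rightarrow> (nat \<Rightarrow> real) \<Rightarrow> real) \<Rightarrow> (nat \<Rightarrow> (nat \<Rightarrow> real) \<Rightarrow> real) \<Rightarrow> bool" where
  "strictly_majorises Xs E E' \<longleftrightarrow> majorises Xs E E' \<and> \<not> majorises Xs E' E"

definition maximal_eprocess :: "real set \<Rightarrow> real \<Rightarrow> (nat \<Rightarrow> (nat \<Rightarrow> real) \<Rightarrow> real) \<Rightarrow> bool" where
  "maximal_eprocess Xs \<mu> E \<longleftrightarrow> eprocess Xs \<mu> E \<and>
     \<not> (\<exists>E'. eprocess Xs \<mu> E' \<and> strictly_majorises Xs E' E)"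

definition majorising_class :: "real set \<Rightarrow> real \<Rightarrow> (nat \<Rightarrow> (nat \<Rightarrow> real) \<Rightarrow> real) set \<Rightarrow> bool" where
  "majorising_class Xs \<mu> C \<longleftrightarrow> (\<forall>E. eprocess Xs \<mu> E \<longrightarrow> (\<exists>E' \<in> C. majorises Xs E' E))"

definition optimal_class :: "real set \<Rightarrow> real \<Rightarrow> (nat \<Rightarrow> (nat \<Rightarrow> real) \<Rightarrow> real) set \<Rightarrow> bool" where
  "optimal_class Xs \<mu> C \<longleftrightarrow> (\<forall>E \<in> C. eprocess Xs \<mu> E) \<and> majorising_class Xs \<mu> C \<and>
     (\<forall>E \<in> C. maximal_eprocess Xs \<mu> E)"

text \<open>Betting strategies: lam t is the paper's lambda_{t+1} : X^t -> I_mu.\<close>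
definition I_mu :: "real \<Rightarrow> real set" where
  "I_mu \<mu> = {1 / (\<mu> - 1) .. 1 / \<mu>}"

definition Lambda_mu :: "real set \<Rightarrow> real \<Rightarrow> (nat \<Rightarrow> (nat \<Rightarrow> real) \<Rightarrow> real) set" where
  "Lambda_mu Xs \<mu> = {lam. (\<forall>t. lam t \<in> borel_measurable (prefix_space Xs t)) \<and>
     (\<forall>t. \<forall>x \<in> space (prefix_space Xs t). lam t x \<in> I_mu \<mu>)}"

definition cb_process :: "real \<Rightarrow> (nat \<Rightarrow> (nat \<Rightarrow> real) \<Rightarrow> real) \<Rightarrow> nat \<Rightarrow> (nat \<Rightarrow> real) \<Rightarrow> real" where
  "cb_process \<mu> lam T x = (\<Prod>t<T. 1 + lam t (restrict x {..<t}) * (x t - \<mu>))"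

definition cb_class :: "real set \<Rightarrow> real \<Rightarrow> (nat \<Rightarrow> (nat \<Rightarrow> real) \<Rightarrow> real) set" where
  "cb_class Xs \<mu> = cb_process \<mu> ` Lambda_mu Xs \<mu>"

end

theory Submission
  imports Defs
begin

text \<open>
  Coin betting against a mean-\<mu> martingale yields a nonnegative martingale, so optional stopping and
  Fatou's lemma make it an e-process. Conversely, given an e-process E and a prefix x, consider every
  value that can be secured from x in expectation by drawing finitely many two-point mean-\<mu> outcomes
  and stopping at a time of one's choice. At the empty prefix these values are at most 1, and mixing
  the attainable values of two one-step extensions y < \<mu> < z of x with mean-\<mu> weights gives an
  attainable value at x. Hence, if L bounds the attainable values at x, then some line through
  (\<mu>, L) with slope L * l, where l lies in I_mu, bounds those at all extensions of x; this l is the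
  next bet. A Borel choice of l exists by Lusin's separation theorem, because the constraints on l
  are projections of Borel sets. Among betting processes, majorisation forces equality, as the
  outcomes 0 and 1 pin down each bet wherever the wealth is positive.
\<close>

section \<open>Lusin separation\<close>

text \<open>The natural wealth at a prefix, the supremum of the attainable values, need not be
  Borel: the values are indexed by real codes of trees, so the supremum is only known to be
  analytic. The recursion therefore never forms it. It carries the Borel wealth built so far,
  starting from the constant 1, and asks only that this wealth be an upper bound \<open>L\<close>.
  Bets and majorisation are required at every single prefix, and no one measure governs all of
  \<open>H_mu\<close>, so a choice of bets that is Borel only off a null set would not do. The
  e-process inequality is used at the empty prefix alone. Later prefixes enter because two-point
  mixtures pass a bound from a prefix to its one-step extensions, so only one new level at the root
  of a tree is needed at a time. The endpoints of \<open>I_mu\<close> are the \<open>l\<close> for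
  which \<open>1 + l * (y - \<mu>)\<close> vanishes at \<open>y = 0\<close> or at
  \<open>y = 1\<close>; nonnegativity of \<open>E\<close> after these outcomes is what makes the
  endpoint slopes steep enough.\<close>

definition borel_separable :: "'a::topological_space set \<Rightarrow> 'a set \<Rightarrow> bool" where
  "borel_separable A B \<longleftrightarrow> (\<exists>C\<in>sets borel. A \<subseteq> C \<and> C \<inter> B = {})"

lemma borel_separable_empty_left: "borel_separable {} B"
  unfolding borel_separable_def by (intro bexI[of _ "{}"]) auto

lemma borel_separable_empty_right: "borel_separable A {}"
  unfolding borel_separable_def by (intro bexI[of _ "UNIV"]) auto

text \<open>Used contrapositively: if two countable unions cannot be separated, then neither can
  some pair of pieces.\<close>

lemma borel_separable_UN:
  fixes A B :: "nat \<Rightarrow> 'a::topological_space set"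
  assumes "\<And>m n. borel_separable (A m) (B n)"
  shows "borel_separable (\<Union>m. A m) (\<Union>n. B n)"
proof -
  obtain C where C: "\<And>m n. C m n \<in> sets borel \<and> A m \<subseteq> C m n \<and> C m n \<inter> B n = {}"
    using assms unfolding borel_separable_def by metis
  have "(\<Union>m. \<Inter>n. C m n) \<in> sets borel"
    using C by auto
  moreover have "A m \<subseteq> (\<Inter>n. C m n)" for m
    using C by auto
  then have "(\<Union>m. A m) \<subseteq> (\<Union>m. \<Inter>n. C m n)"
    by (rule UN_mono[OF subset_refl])
  moreover have "(\<Inter>n. C m n) \<inter> B n = {}" for m n
    using C[of m n] by auto
  then have "(\<Union>m. \<Inter>n. C m n) \<inter> (\<Union>n. B n) = {}"
    by auto
  ultimately show ?thesis
    unfolding borel_separable_def by blast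
qed

lemma countable_cball_cover:
  fixes e :: real
  assumes "0 < e"
  obtains c :: "nat \<Rightarrow> 'a::{metric_space, second_countable_topology}" where "(\<Union>n. cball (c n) e) = UNIV"
proof -
  obtain D :: "'a set" where D: "countable D" "\<And>X. open X \<Longrightarrow> X \<noteq> {} \<Longrightarrow> \<exists>d\<in>D. d \<in> X"
    using countable_dense_setE by blast
  have ne: "D \<noteq> {}" using D(2)[of UNIV] by auto
  have "x \<in> (\<Union>n. cball (from_nat_into D n) e)" for x
  proof -
    obtain d where "d \<in> D" "d \<in> ball x e"
      using D(2)[of "ball x e"] assms by auto
    moreover then obtain n where "d = from_nat_into D n"
      using D(1) from_nat_into_surj by metis
    ultimately show ?thesis by (auto simp: dist_commute intro!: exI[of _ n])
  qed
  then show thesis using that by blast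
qed

lemma dist_less_in_cball:
  fixes x y c :: "'a::metric_space"
  assumes "A \<subseteq> cball c r" "r < e / 2" "x \<in> A" "y \<in> A"
  shows "dist x y < e"
proof -
  have "x \<in> cball c r" "y \<in> cball c r" using assms by blast+
  then have "dist c x < e / 2" "dist c y < e / 2" using assms(2) by auto
  then show ?thesis by (metis dist_commute dist_triangle_half_r)
qed

text \<open>If the images were inseparable, repeated cutting into countably many small pieces would
  keep an inseparable pair at every stage. By completeness the pieces shrink to points
  \<open>a\<close> and \<open>b\<close>. Since \<open>f a\<close> and \<open>g b\<close> differ,
  disjoint open sets around them contain the images of late pieces, and an open set then separates
  that pair.\<close>

lemma borel_separable_image_closed:
  fixes F :: "'a::{complete_space, second_countable_topology} set"
    and G :: "'b::{complete_space, second_countable_topology} set"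
    and f :: "'a \<Rightarrow> 'c::t2_space"
  assumes "closed F" "closed G" "continuous_on F f" "continuous_on G g" "f ` F \<inter> g ` G = {}"
  shows "borel_separable (f ` F) (g ` G)"
proof (rule ccontr)
  assume nsep: "\<not> borel_separable (f ` F) (g ` G)"
  \<comment> \<open>The guard \<open>n > 0\<close> matters: division by zero gives radius 0, which
    would force the initial sets into single points.\<close>
  define P where "P = (\<lambda>n (p :: 'a set \<times> 'b set). closed (fst p) \<and> closed (snd p) \<and> fst p \<subseteq> F \<and> snd p \<subseteq> G
     \<and> \<not> borel_separable (f ` fst p) (g ` snd p)
     \<and> (n > 0 \<longrightarrow> (\<exists>c. fst p \<subseteq> cball c (1 / real n)) \<and> (\<exists>c. snd p \<subseteq> cball c (1 / real n))))"
  have step: "\<exists>q. P (Suc n) q \<and> (fst q \<subseteq> fst p \<and> snd q \<subseteq> snd p)" if "P n p" for n p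
  proof -
    have e: "0 < 1 / real (Suc n)" by simp
    obtain c :: "nat \<Rightarrow> 'a" where c: "(\<Union>k. cball (c k) (1 / real (Suc n))) = UNIV"
      using countable_cball_cover[OF e] by blast
    obtain d :: "nat \<Rightarrow> 'b" where d: "(\<Union>k. cball (d k) (1 / real (Suc n))) = UNIV"
      using countable_cball_cover[OF e] by blast
    have 1: "f ` fst p = (\<Union>k. f ` (fst p \<inter> cball (c k) (1 / real (Suc n))))"
      using c by blast
    have 2: "g ` snd p = (\<Union>k. g ` (snd p \<inter> cball (d k) (1 / real (Suc n))))"
      using d by blast
    have "\<not> borel_separable (f ` fst p) (g ` snd p)"
      using that by (simp add: P_def)
    then obtain k l where
      "\<not> borel_separable (f ` (fst p \<inter> cball (c k) (1 / real (Suc n)))) (g ` (snd p \<inter> cball (d l) (1 / real (Suc n))))"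
      unfolding 1 2 using borel_separable_UN[of "\<lambda>k. f ` (fst p \<inter> cball (c k) (1 / real (Suc n)))"
          "\<lambda>l. g ` (snd p \<inter> cball (d l) (1 / real (Suc n)))"] by auto
    then have "P (Suc n) (fst p \<inter> cball (c k) (1 / real (Suc n)), snd p \<inter> cball (d l) (1 / real (Suc n)))"
      using that unfolding P_def by auto
    then show ?thesis by force
  qed
  have "P 0 (F, G)" using assms nsep by (simp add: P_def)
  then have "\<exists>S. \<forall>n. P n (S n) \<and> (fst (S (Suc n)) \<subseteq> fst (S n) \<and> snd (S (Suc n)) \<subseteq> snd (S n))"
    using step by (intro dependent_nat_choice) auto
  then obtain S where S: "\<And>n. P n (S n)"
    and dec: "\<And>n. fst (S (Suc n)) \<subseteq> fst (S n)" "\<And>n. snd (S (Suc n)) \<subseteq> snd (S n)"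
    by blast
  have ne: "fst (S n) \<noteq> {}" "snd (S n) \<noteq> {}" for n
    using S[of n] unfolding P_def by (auto simp: borel_separable_empty_left borel_separable_empty_right)
  have small: "\<exists>n. (\<forall>x\<in>fst (S n). \<forall>y\<in>fst (S n). dist x y < e) \<and> (\<forall>x\<in>snd (S n). \<forall>y\<in>snd (S n). dist x y < e)"
    if "e > 0" for e :: real
  proof -
    have "0 < e / 2" using that by simp
    then obtain k where k: "1 / real (Suc k) < e / 2"
      by (rule nat_approx_posE)
    define n where "n = Suc k"
    have n: "n > 0" "1 / real n < e / 2" using k by (simp_all add: n_def)
    obtain c d where c: "fst (S n) \<subseteq> cball c (1 / real n)" and d: "snd (S n) \<subseteq> cball d (1 / real n)"
      using S[of n] n(1) unfolding P_def by blast
    show ?thesis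
      by (intro exI[of _ n] conjI ballI dist_less_in_cball[OF c n(2)] dist_less_in_cball[OF d n(2)])
  qed
  have mono: "fst (S n) \<subseteq> fst (S m)" "snd (S n) \<subseteq> snd (S m)" if "m \<le> n" for m n
    using lift_Suc_antimono_le[of "\<lambda>n. fst (S n)" m n] lift_Suc_antimono_le[of "\<lambda>n. snd (S n)" m n] dec that by auto
  obtain a where a: "\<And>n. a \<in> fst (S n)"
  proof (rule decreasing_closed_nest[of "\<lambda>n. fst (S n)"])
    show "closed (fst (S n))" for n using S[of n] by (simp add: P_def)
    show "fst (S n) \<noteq> {}" for n by (rule ne)
    show "fst (S n) \<subseteq> fst (S m)" if "m \<le> n" for m n using that by (rule mono)
    show "\<exists>n. \<forall>x\<in>fst (S n). \<forall>y\<in>fst (S n). dist x y < e" if "0 < e" for e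
      using small[OF that] by (elim exE conjE) (rule exI)
  qed (rule that)
  obtain b where b: "\<And>n. b \<in> snd (S n)"
  proof (rule decreasing_closed_nest[of "\<lambda>n. snd (S n)"])
    show "closed (snd (S n))" for n using S[of n] by (simp add: P_def)
    show "snd (S n) \<noteq> {}" for n by (rule ne)
    show "snd (S n) \<subseteq> snd (S m)" if "m \<le> n" for m n using that by (rule mono)
    show "\<exists>n. \<forall>x\<in>snd (S n). \<forall>y\<in>snd (S n). dist x y < e" if "0 < e" for e
      using small[OF that] by (elim exE conjE) (rule exI)
  qed (rule that)
  have ab: "a \<in> F" "b \<in> G" using a[of 0] b[of 0] S[of 0] by (auto simp: P_def)
  then have "f a \<noteq> g b" using assms(5) by blast
  from hausdorff[OF this] obtain U V where UV: "open U" "open V" "f a \<in> U" "g b \<in> V" "U \<inter> V = {}"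
    by blast
  obtain U' where U': "open U'" "U' \<inter> F = f -` U \<inter> F"
    using assms(3) UV(1) continuous_on_open_invariant by metis
  obtain V' where V': "open V'" "V' \<inter> G = g -` V \<inter> G"
    using assms(4) UV(2) continuous_on_open_invariant by metis
  have "a \<in> U'" "b \<in> V'" using U' V' ab UV by blast+
  then obtain e1 e2 where e: "e1 > 0" "ball a e1 \<subseteq> U'" "e2 > 0" "ball b e2 \<subseteq> V'"
    using U'(1) V'(1) open_contains_ball by metis
  obtain n where n: "\<forall>x\<in>fst (S n). \<forall>y\<in>fst (S n). dist x y < min e1 e2"
      "\<forall>x\<in>snd (S n). \<forall>y\<in>snd (S n). dist x y < min e1 e2"
    using small[of "min e1 e2"] e by auto
  have "fst (S n) \<subseteq> F" "snd (S n) \<subseteq> G" using S[of n] by (auto simp: P_def)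
  then have "f ` fst (S n) \<subseteq> U" "g ` snd (S n) \<subseteq> V"
    using n a[of n] b[of n] e U'(2) V'(2) by (auto simp: subset_iff set_eq_iff)
  then have "borel_separable (f ` fst (S n)) (g ` snd (S n))"
    unfolding borel_separable_def using UV by (intro bexI[of _ U]) auto
  then show False using S[of n] by (simp add: P_def)
qed

text \<open>These are the analytic sets in disguise. The fibre \<open>nat \<Rightarrow> real\<close>
  is Polish, and one of its points can code an index or a whole sequence of witnesses, so the same
  fibre type serves after countable unions and intersections.\<close>

definition closed_projection :: "'a::topological_space set \<Rightarrow> bool" where
  "closed_projection A \<longleftrightarrow> (\<exists>F :: ('a \<times> (nat \<Rightarrow> real)) set. closed F \<and> A = fst ` F)"

lemma closed_projectionI_closed: "closed A \<Longrightarrow> closed_projection A"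
  unfolding closed_projection_def
  by (intro exI[of _ "A \<times> UNIV"]) (auto intro: closed_Times)

lemma continuous_on_reindex: "continuous_on S (\<lambda>p. (fst p, \<lambda>k. snd p (h k)))"
  for S :: "('a::topological_space \<times> (nat \<Rightarrow> real)) set"
  by (intro continuous_intros continuous_on_coordinatewise_then_product continuous_on_product_then_coordinatewise[OF continuous_on_snd[OF continuous_on_id]])

lemma closed_reindex:
  fixes F :: "('a::topological_space \<times> (nat \<Rightarrow> real)) set"
  assumes "closed F"
  shows "closed {p :: 'a \<times> (nat \<Rightarrow> real). (fst p, \<lambda>k. snd p (h k)) \<in> F}"
  using continuous_closed_preimage[OF continuous_on_reindex[of UNIV h] closed_UNIV assms]
  by (simp add: vimage_def)

lemma closed_projection_UN:
  assumes "\<And>n::nat. closed_projection (A n)"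
  shows "closed_projection (\<Union>n. A n)"
proof -
  obtain F where F: "\<And>n. closed (F n) \<and> A n = fst ` (F n :: ('a \<times> (nat \<Rightarrow> real)) set)"
    using assms unfolding closed_projection_def by metis
  \<comment> \<open>Entry 0 names the index and the later entries are the witness for that
    \<open>F n\<close>. The condition reads: for every \<open>n\<close>, the index differs from
    \<open>n\<close> or the witness lies in \<open>F n\<close>. An intersection of finite unions
    stays closed, while a union over all indices need not.\<close>
  define G where "G = {p :: 'a \<times> (nat \<Rightarrow> real). snd p 0 \<in> range of_nat} \<inter>
     (\<Inter>n. {p. snd p 0 \<in> of_nat ` (UNIV - {n})} \<union> {p. (fst p, \<lambda>k. snd p (Suc k)) \<in> F n})"
  have c0: "continuous_on UNIV (\<lambda>p :: 'a \<times> (nat \<Rightarrow> real). snd p 0)"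
    by (intro continuous_on_product_then_coordinatewise[OF continuous_on_snd[OF continuous_on_id]])
  have "closed {p :: 'a \<times> (nat \<Rightarrow> real). snd p 0 \<in> of_nat ` N}" for N
    using continuous_closed_preimage[OF c0 closed_UNIV closed_of_nat_image[of N]] by (simp add: vimage_def)
  then have "closed G"
    unfolding G_def using F by (intro closed_Int closed_INT closed_Un ballI closed_reindex) auto
  moreover have "(\<Union>n. A n) = fst ` G"
  proof (intro set_eqI iffI)
    fix x assume "x \<in> (\<Union>n. A n)"
    then obtain n w where "(x, w) \<in> F n" using F by fastforce
    then have "(x, case_nat (of_nat n) w) \<in> G"
      by (auto simp: G_def)
    then show "x \<in> fst ` G" by force
  next
    fix x assume "x \<in> fst ` G"
    then obtain w where w: "(x, w) \<in> G" by auto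
    then obtain n where "w 0 = of_nat n" by (auto simp: G_def)
    then have "(x, \<lambda>k. w (Suc k)) \<in> F n" using w by (auto simp: G_def)
    then show "x \<in> (\<Union>n. A n)" using F by force
  qed
  ultimately show ?thesis unfolding closed_projection_def by blast
qed

text \<open>A single sequence carries one witness for each \<open>A n\<close>, interleaved by
  \<open>prod_encode\<close>.\<close>

lemma closed_projection_INT:
  assumes "\<And>n::nat. closed_projection (A n)"
  shows "closed_projection (\<Inter>n. A n)"
proof -
  obtain F where F: "\<And>n. closed (F n) \<and> A n = fst ` (F n :: ('a \<times> (nat \<Rightarrow> real)) set)"
    using assms unfolding closed_projection_def by metis
  define G where "G = (\<Inter>n. {p. (fst p, \<lambda>k. snd p (prod_encode (n, k))) \<in> F n})"
  have "closed G"
    unfolding G_def using F by (intro closed_INT ballI closed_reindex) auto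
  moreover have "(\<Inter>n. A n) = fst ` G"
  proof (intro set_eqI iffI)
    fix x assume "x \<in> (\<Inter>n. A n)"
    then have "\<forall>n. \<exists>w. (x, w) \<in> F n" using F by fastforce
    then obtain w where w: "\<And>n. (x, w n) \<in> F n" by metis
    define v where "v = (\<lambda>m. case prod_decode m of (n, k) \<Rightarrow> w n k)"
    have "(x, v) \<in> G"
      using w by (auto simp: G_def v_def)
    then show "x \<in> fst ` G" by force
  next
    fix x assume "x \<in> fst ` G"
    then show "x \<in> (\<Inter>n. A n)" using F by (force simp: G_def)
  qed
  ultimately show ?thesis unfolding closed_projection_def by blast
qed

lemma closed_projection_open:
  fixes U :: "'a::metric_space set"
  assumes "open U"
  shows "closed_projection U"
proof (cases "U = UNIV")
  case True
  then show ?thesis by (simp add: closed_projectionI_closed)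
next
  case False
  then have ne: "- U \<noteq> {}" by auto
  have "U = (\<Union>n. {x. 1 / real (Suc n) \<le> infdist x (- U)})"
  proof (intro set_eqI iffI)
    fix x assume "x \<in> U"
    then have "infdist x (- U) > 0"
      using assms in_closed_iff_infdist_zero[of "- U" x] ne infdist_nonneg[of x "- U"] by (auto simp: less_le)
    then obtain n where "1 / real (Suc n) < infdist x (- U)"
      using nat_approx_posE by blast
    then show "x \<in> (\<Union>n. {x. 1 / real (Suc n) \<le> infdist x (- U)})" by (auto intro: less_imp_le)
  next
    fix x assume "x \<in> (\<Union>n. {x. 1 / real (Suc n) \<le> infdist x (- U)})"
    then obtain n where "1 / real (Suc n) \<le> infdist x (- U)" by auto
    moreover have "0 < 1 / real (Suc n)" by simp
    ultimately have "infdist x (- U) \<noteq> 0" by linarith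
    then show "x \<in> U" using infdist_zero by blast
  qed
  moreover have "closed {x. 1 / real (Suc n) \<le> infdist x (- U)}" for n
    by (intro closed_Collect_le continuous_intros)
  ultimately show ?thesis
    using closed_projection_UN closed_projectionI_closed by (metis (no_types, lifting))
qed

text \<open>Projections do not commute with complements, so the induction over the sigma-algebra
  proves the claim for a set and its complement together.\<close>

lemma closed_projection_borel:
  fixes A :: "'a::metric_space set"
  assumes "A \<in> sets borel"
  shows "closed_projection A"
proof -
  have "A \<in> sigma_sets UNIV {S. open S}" using assms by (simp add: borel_def)
  then have "closed_projection A \<and> closed_projection (- A)"
  proof (induction rule: sigma_sets.induct)
    case (Basic a)
    then show ?case by (auto intro: closed_projection_open closed_projectionI_closed)
  next
    case Empty
    then show ?case by (simp add: closed_projectionI_closed)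
  next
    case (Compl a)
    then show ?case by (simp add: Compl_eq_Diff_UNIV[symmetric])
  next
    case (Union a)
    then show ?case by (simp add: closed_projection_UN closed_projection_INT)
  qed
  then show ?thesis ..
qed

text \<open>A Borel set is itself a projection of a closed set, so its projection is a continuous
  image of a closed set in a larger complete space.\<close>

theorem lusin_separation:
  fixes A B :: "('a::{complete_space, second_countable_topology} \<times> 'b::{complete_space, second_countable_topology}) set"
  assumes "A \<in> sets borel" "B \<in> sets borel" "fst ` A \<inter> fst ` B = {}"
  shows "borel_separable (fst ` A) (fst ` B)"
proof -
  obtain F G :: "(('a \<times> 'b) \<times> (nat \<Rightarrow> real)) set"
    where F: "closed F" "A = fst ` F" and G: "closed G" "B = fst ` G"
    using assms(1,2)[THEN closed_projection_borel] unfolding closed_projection_def by blast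
  have "borel_separable ((\<lambda>p. fst (fst p)) ` F) ((\<lambda>p. fst (fst p)) ` G)"
    using assms(3) F G by (intro borel_separable_image_closed continuous_intros) (auto simp: image_image)
  then show ?thesis by (simp add: F(2) G(2) image_image)
qed

section \<open>Betting processes are e-processes\<close>

lemma cb_process_restrict: "cb_process \<mu> lam T (restrict x {..<T}) = cb_process \<mu> lam T x"
proof -
  have "restrict (restrict x {..<T}) {..<t} = restrict x {..<t}" if "t < T" for t
    using that by (auto simp: restrict_def fun_eq_iff)
  then show ?thesis by (simp add: cb_process_def)
qed

section \<open>Prefix spaces, the natural filtration and stopping times\<close>

locale bounded_mean =
  fixes Xs :: "real set" and \<mu> :: real
  assumes Xs_borel: "Xs \<in> sets borel" and Xs_subset: "Xs \<subseteq> {0..1}"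
    and zero_in: "0 \<in> Xs" and one_in: "1 \<in> Xs"
    and mu_pos: "0 < \<mu>" and mu_less: "\<mu> < 1"
begin

abbreviation seqs :: "(nat \<Rightarrow> real) measure" where "seqs \<equiv> seq_space Xs"
abbreviation prefixes :: "nat \<Rightarrow> (nat \<Rightarrow> real) measure" where "prefixes t \<equiv> prefix_space Xs t"
abbreviation past :: "nat \<Rightarrow> (nat \<Rightarrow> real) measure" where "past t \<equiv> filt Xs seqs t"

lemma space_coord: "space (coord_space Xs) = Xs"
  by (simp add: coord_space_def space_restrict_space)

lemma space_seqs: "space seqs = {x. \<forall>i. x i \<in> Xs}"
  by (auto simp: seq_space_def space_PiM space_coord)

lemma space_prefixes: "space (prefixes t) = PiE {..<t} (\<lambda>_. Xs)"
  by (simp add: prefix_space_def space_PiM space_coord)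

lemma coord_in_unit: "x \<in> Xs \<Longrightarrow> 0 \<le> x \<and> x \<le> 1"
  using Xs_subset by auto

lemma measurable_coord_borel: "(\<lambda>x. x) \<in> coord_space Xs \<rightarrow>\<^sub>M borel"
  unfolding coord_space_def by (rule measurable_restrict_space1) simp

lemma measurable_coord [measurable]: "(\<lambda>x. x s) \<in> borel_measurable seqs"
  unfolding seq_space_def
  by (rule measurable_compose[OF measurable_component_singleton[of s] measurable_coord_borel]) simp

lemma measurable_coord_prefixes: "s < t \<Longrightarrow> (\<lambda>x. x s) \<in> borel_measurable (prefixes t)"
  unfolding prefix_space_def
  by (rule measurable_compose[OF measurable_component_singleton[of s] measurable_coord_borel]) simp

lemma measurable_prefix [measurable]: "(\<lambda>x. restrict x {..<t}) \<in> seqs \<rightarrow>\<^sub>M prefixes t"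
  unfolding seq_space_def prefix_space_def by (rule measurable_restrict_subset) simp

lemma measurable_prefix_prefix: "s \<le> t \<Longrightarrow> (\<lambda>x. restrict x {..<s}) \<in> prefixes t \<rightarrow>\<^sub>M prefixes s"
  unfolding prefix_space_def by (rule measurable_restrict_subset) auto

lemma prefix_in_space: "x \<in> space seqs \<Longrightarrow> restrict x {..<t} \<in> space (prefixes t)"
  by (auto simp: space_seqs space_prefixes)

lemma prefix_prefix_in_space: "x \<in> space (prefixes t) \<Longrightarrow> s \<le> t \<Longrightarrow> restrict x {..<s} \<in> space (prefixes s)"
  by (auto simp: space_prefixes PiE_iff)

lemma filt_eq_past: "sets M = sets seqs \<Longrightarrow> filt Xs M t = past t"
  unfolding filt_def by (drule sets_eq_imp_space_eq) (simp only:)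

lemma space_past [simp]: "space (past t) = space seqs"
  by (simp add: filt_def)

lemma sets_past: "sets (past t) = {(\<lambda>x. restrict x {..<t}) -` B \<inter> space seqs | B. B \<in> sets (prefixes t)}"
  unfolding filt_def by (intro sets_vimage_algebra2 funcsetI prefix_in_space)

lemma measurable_past: "g \<in> borel_measurable (prefixes t) \<Longrightarrow> (\<lambda>x. g (restrict x {..<t})) \<in> borel_measurable (past t)"
  unfolding filt_def
  by (rule measurable_compose[OF measurable_vimage_algebra1]) (intro funcsetI prefix_in_space)

lemma past_subset: "sets (past t) \<subseteq> sets seqs"
  unfolding sets_past using measurable_sets[OF measurable_prefix] by auto

lemma past_mono: "s \<le> t \<Longrightarrow> sets (past s) \<subseteq> sets (past t)"
proof
  fix A assume st: "s \<le> t" and "A \<in> sets (past s)"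
  then obtain B where B: "B \<in> sets (prefixes s)" "A = (\<lambda>x. restrict x {..<s}) -` B \<inter> space seqs"
    by (auto simp: sets_past)
  define C where "C = (\<lambda>x. restrict x {..<s}) -` B \<inter> space (prefixes t)"
  have "C \<in> sets (prefixes t)"
    unfolding C_def using measurable_prefix_prefix[OF st] B(1) by (rule measurable_sets)
  moreover have "restrict (restrict x {..<t}) {..<s} = restrict x {..<s}" for x :: "nat \<Rightarrow> real"
    using st by (auto simp: restrict_def fun_eq_iff)
  then have "A = (\<lambda>x. restrict x {..<t}) -` C \<inter> space seqs"
    by (auto simp: B(2) C_def prefix_in_space)
  ultimately show "A \<in> sets (past t)" by (auto simp: sets_past)
qed

lemma stopping_time_eq: "finite_stopping_time Xs \<tau> \<Longrightarrow> {x \<in> space seqs. \<tau> x = t} \<in> sets (past t)"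
  by (simp add: finite_stopping_time_def)

lemma stopping_time_greater:
  assumes "finite_stopping_time Xs \<tau>"
  shows "{x \<in> space seqs. n < \<tau> x} \<in> sets (past n)"
proof -
  have "{x \<in> space seqs. n < \<tau> x} = space (past n) - (\<Union>t\<le>n. {x \<in> space seqs. \<tau> x = t})"
    by (auto simp: not_less)
  moreover have "{x \<in> space seqs. \<tau> x = t} \<in> sets (past n)" if "t \<le> n" for t
    using stopping_time_eq[OF assms] past_mono[OF that] by blast
  ultimately show ?thesis using sets.top[of "past n"] by (auto intro!: sets.Diff sets.finite_UN)
qed

lemma stopping_time_measurable:
  assumes "finite_stopping_time Xs \<tau>"
  shows "\<tau> \<in> seqs \<rightarrow>\<^sub>M count_space UNIV"
proof (rule measurable_count_space_eq2_countable[THEN iffD2])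
  have "\<tau> -` {t} \<inter> space seqs \<in> sets seqs" for t
  proof -
    have "\<tau> -` {t} \<inter> space seqs = {x \<in> space seqs. \<tau> x = t}" by auto
    then show ?thesis using subsetD[OF past_subset stopping_time_eq[OF assms]] by simp
  qed
  then show "\<tau> \<in> space seqs \<rightarrow> UNIV \<and> (\<forall>a\<in>UNIV. \<tau> -` {a} \<inter> space seqs \<in> sets seqs)" by auto
qed

lemma stopped_measurable:
  assumes "finite_stopping_time Xs \<tau>" "\<And>t. E t \<in> borel_measurable (prefixes t)"
  shows "stopped E \<tau> \<in> borel_measurable seqs"
  unfolding stopped_def
  by (rule measurable_compose_countable[OF measurable_compose[OF measurable_prefix assms(2)] stopping_time_measurable[OF assms(1)]])

lemma I_mu_bound: "l \<in> I_mu \<mu> \<Longrightarrow> \<bar>l\<bar> \<le> 1 / \<mu> + 1 / (1 - \<mu>)"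
proof -
  assume "l \<in> I_mu \<mu>"
  moreover have "1 / (\<mu> - 1) = - (1 / (1 - \<mu>))" using mu_less by (simp add: field_simps)
  moreover have "0 < 1 / \<mu>" "0 < 1 / (1 - \<mu>)" using mu_pos mu_less by auto
  ultimately show ?thesis unfolding I_mu_def atLeastAtMost_iff by linarith
qed

text \<open>The factor is affine in \<open>y\<close>; it vanishes at \<open>y = 0\<close> for
  \<open>l = 1 / \<mu>\<close> and at \<open>y = 1\<close> for \<open>l = 1 / (\<mu> - 1)\<close>,
  the two extreme bets.\<close>

lemma bet_nonneg:
  assumes "l \<in> I_mu \<mu>" "0 \<le> y" "y \<le> 1"
  shows "0 \<le> 1 + l * (y - \<mu>)"
proof (cases "y \<le> \<mu>")
  case True
  then have "l * (\<mu> - y) \<le> 1 / \<mu> * \<mu>"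
    using assms mu_pos by (intro mult_mono) (auto simp: I_mu_def)
  then show ?thesis using mu_pos by (simp add: algebra_simps)
next
  case False
  have "(- l) * (y - \<mu>) \<le> 1 / (1 - \<mu>) * (1 - \<mu>)"
  proof (intro mult_mono)
    have "1 / (\<mu> - 1) = - (1 / (1 - \<mu>))" using mu_less by (simp add: field_simps)
    then show "- l \<le> 1 / (1 - \<mu>)" using assms by (auto simp: I_mu_def)
  qed (use assms False mu_less in auto)
  then show ?thesis using mu_less by (simp add: algebra_simps)
qed

lemma bet_bound:
  assumes "l \<in> I_mu \<mu>" "0 \<le> y" "y \<le> 1"
  shows "\<bar>1 + l * (y - \<mu>)\<bar> \<le> 1 + 1 / \<mu> + 1 / (1 - \<mu>)"
proof -
  have "\<bar>l * (y - \<mu>)\<bar> \<le> (1 / \<mu> + 1 / (1 - \<mu>)) * 1"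
    unfolding abs_mult using I_mu_bound[OF assms(1)] assms mu_pos mu_less by (intro mult_mono) auto
  then show ?thesis unfolding mult_1_right by linarith
qed

context
  fixes lam assumes lam: "lam \<in> Lambda_mu Xs \<mu>"
begin

lemma lam_measurable: "lam t \<in> borel_measurable (prefixes t)"
  using lam by (simp add: Lambda_mu_def)

lemma lam_range: "x \<in> space (prefixes t) \<Longrightarrow> lam t x \<in> I_mu \<mu>"
  using lam by (simp add: Lambda_mu_def)

lemma cb_process_measurable: "cb_process \<mu> lam T \<in> borel_measurable (prefixes T)"
proof -
  have "(\<lambda>x. 1 + lam t (restrict x {..<t}) * (x t - \<mu>)) \<in> borel_measurable (prefixes T)" if "t < T" for t
    using measurable_compose[OF measurable_prefix_prefix lam_measurable, of t T] that
      measurable_coord_prefixes[OF that]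
    by (intro borel_measurable_add borel_measurable_times borel_measurable_diff borel_measurable_const) simp_all
  then show ?thesis
    unfolding cb_process_def[abs_def] by (intro borel_measurable_prod) simp
qed

lemma cb_process_nonneg:
  assumes "x \<in> space (prefixes T)"
  shows "0 \<le> cb_process \<mu> lam T x"
  unfolding cb_process_def
proof (intro prod_nonneg ballI)
  fix t assume "t \<in> {..<T}"
  then have "x t \<in> Xs" "t \<le> T" using assms by (auto simp: space_prefixes)
  then show "0 \<le> 1 + lam t (restrict x {..<t}) * (x t - \<mu>)"
    using coord_in_unit by (intro bet_nonneg lam_range prefix_prefix_in_space[OF assms]) auto
qed

lemma cb_process_bound:
  assumes "x \<in> space seqs"
  shows "\<bar>cb_process \<mu> lam T x\<bar> \<le> (1 + 1 / \<mu> + 1 / (1 - \<mu>)) ^ T"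
proof -
  have "(\<Prod>t<T. \<bar>1 + lam t (restrict x {..<t}) * (x t - \<mu>)\<bar>) \<le> (\<Prod>t<T. 1 + 1 / \<mu> + 1 / (1 - \<mu>))"
    using assms coord_in_unit
    by (intro prod_mono conjI bet_bound lam_range prefix_in_space) (auto simp: space_seqs)
  then show ?thesis by (simp add: cb_process_def abs_prod)
qed

text \<open>Truncation at \<open>min (\<tau> x) n\<close> bounds the wealth by a power of a
  constant, so each expectation is that of a bounded function and stays equal to 1. As
  \<open>\<tau>\<close> is finite but possibly unbounded, the passage to the limit keeps only the
  inequality.\<close>

lemma cb_process_eprocess: "eprocess Xs \<mu> (cb_process \<mu> lam)"
  unfolding eprocess_def
proof (intro conjI allI ballI impI cb_process_measurable cb_process_nonneg)
  fix P \<tau> assume P: "P \<in> H_mu Xs \<mu>" and \<tau>: "finite_stopping_time Xs \<tau>"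
  have setsP: "sets P = sets seqs" and pP: "prob_space P"
    and cond: "\<And>t. AE x in P. real_cond_exp P (past t) (\<lambda>y. y t) x = \<mu>"
    using P filt_eq_past[of P] by (auto simp: H_mu_def)
  interpret P: prob_space P by (rule pP)
  have spaceP: "space P = space seqs" using setsP by (rule sets_eq_imp_space_eq)
  have measP: "measurable P = measurable seqs" using setsP by (intro ext measurable_cong_sets) auto
  define K where "K = 1 + 1 / \<mu> + 1 / (1 - \<mu>)"
  have K: "1 \<le> K" using mu_pos mu_less by (simp add: K_def)
  have sub: "finite_measure_subalgebra P (past t)" for t
    by (intro finite_measure_subalgebra.intro finite_measure_subalgebra_axioms.intro P.finite_measure_axioms)
       (use past_subset setsP spaceP in \<open>auto simp: subalgebra_def\<close>)
  define M where "M n x = cb_process \<mu> lam (min (\<tau> x) n) x" for n x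
  have min_meas: "(\<lambda>x. min (\<tau> x) n) \<in> seqs \<rightarrow>\<^sub>M count_space UNIV" for n
    using stopping_time_measurable[OF \<tau>] by measurable
  have cb_meas: "cb_process \<mu> lam t \<in> borel_measurable seqs" for t
    using measurable_compose[OF measurable_prefix cb_process_measurable] by (simp add: cb_process_restrict)
  have M_meas: "M n \<in> borel_measurable P" for n
    unfolding measP M_def by (rule measurable_compose_countable[OF cb_meas min_meas])
  have M_bound: "\<bar>M n x\<bar> \<le> K ^ n" if "x \<in> space seqs" for n x
  proof -
    have "\<bar>M n x\<bar> \<le> K ^ min (\<tau> x) n" unfolding M_def K_def by (rule cb_process_bound[OF that])
    also have "\<dots> \<le> K ^ n" using K by (intro power_increasing) auto
    finally show ?thesis .
  qed
  have M_int: "integrable P (M n)" for n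
    using M_bound M_meas spaceP by (intro P.integrable_const_bound[where B = "K ^ n"]) (auto intro!: AE_I2)
  have M_nonneg: "0 \<le> M n x" if "x \<in> space P" for n x
    using cb_process_nonneg[OF prefix_in_space, of x "min (\<tau> x) n"] that spaceP
    by (simp add: M_def cb_process_restrict)
  have M_expectation: "(\<integral>x. M n x \<partial>P) = 1" for n
  proof (induction n)
    case 0
    show ?case by (simp add: M_def cb_process_def P.prob_space)
  next
    case (Suc n)
    interpret sub: finite_measure_subalgebra P "past n" by (rule sub)
    \<comment> \<open>The stake at time \<open>n\<close>: wealth times bet on the event that the
      process is still running. It is known at time \<open>n\<close>, so replacing the next outcome
      by its conditional mean \<mu> makes the increment vanish in expectation.\<close>
    define f where "f x = indicator {x \<in> space seqs. n < \<tau> x} x * (cb_process \<mu> lam n (restrict x {..<n}) * lam n (restrict x {..<n}))" for x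
    have f_meas: "f \<in> borel_measurable (past n)"
      unfolding f_def using measurable_past[OF cb_process_measurable] measurable_past[OF lam_measurable]
        stopping_time_greater[OF \<tau>]
      by (intro borel_measurable_times borel_measurable_indicator)
    have f_bound: "\<bar>f x\<bar> \<le> K ^ n * K" if "x \<in> space P" for x
    proof -
      have "\<bar>cb_process \<mu> lam n x\<bar> * \<bar>lam n (restrict x {..<n})\<bar> \<le> K ^ n * K"
        using cb_process_bound[of x n] I_mu_bound[OF lam_range[OF prefix_in_space], of x n] that spaceP K
        by (intro mult_mono) (auto simp: K_def)
      then show ?thesis using K by (auto simp: f_def indicator_def cb_process_restrict abs_mult)
    qed
    have f_meas': "f \<in> borel_measurable P"
      using measurable_from_subalg[OF sub.subalg f_meas] .
    have f_int: "integrable P f"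
      using f_bound f_meas' by (intro P.integrable_const_bound[where B = "K ^ n * K"]) (auto intro!: AE_I2)
    have fx_int: "integrable P (\<lambda>x. f x * x n)"
    proof (rule P.integrable_const_bound[where B = "K ^ n * K * 1"])
      show "AE x in P. norm (f x * x n) \<le> K ^ n * K * 1"
      proof (rule AE_I2)
        fix x assume x: "x \<in> space P"
        then have "\<bar>x n\<bar> \<le> 1" using coord_in_unit spaceP by (auto simp: space_seqs)
        then show "norm (f x * x n) \<le> K ^ n * K * 1"
          using f_bound[OF x] K unfolding real_norm_def abs_mult by (intro mult_mono) auto
      qed
      show "(\<lambda>x. f x * x n) \<in> borel_measurable P"
        using f_meas' measurable_coord[of n] unfolding measP by (rule borel_measurable_times)
    qed
    have "(\<integral>x. f x * x n \<partial>P) = (\<integral>x. f x * real_cond_exp P (past n) (\<lambda>y. y n) x \<partial>P)"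
      using sub.real_cond_exp_intg(2)[OF fx_int f_meas] measurable_coord[of n] unfolding measP by simp
    also have "\<dots> = (\<integral>x. f x * \<mu> \<partial>P)"
      using cond[of n] f_meas' measurable_from_subalg[OF sub.subalg borel_measurable_cond_exp[of P "past n" "\<lambda>y. y n"]]
      by (intro integral_cong_AE) auto
    finally have eq: "(\<integral>x. f x * x n \<partial>P) = (\<integral>x. f x * \<mu> \<partial>P)" .
    have "M (Suc n) x = M n x + (f x * x n - f x * \<mu>)" if "x \<in> space P" for x
    proof (cases "n < \<tau> x")
      case True
      then have "min (\<tau> x) (Suc n) = Suc n" "min (\<tau> x) n = n" by auto
      then show ?thesis using True that spaceP
        by (simp add: M_def f_def cb_process_restrict) (simp add: cb_process_def algebra_simps)
    next
      case False
      then show ?thesis by (simp add: M_def f_def)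
    qed
    then have "(\<integral>x. M (Suc n) x \<partial>P) = (\<integral>x. M n x + (f x * x n - f x * \<mu>) \<partial>P)"
      by (intro Bochner_Integration.integral_cong) auto
    also have "\<dots> = (\<integral>x. M n x \<partial>P) + ((\<integral>x. f x * x n \<partial>P) - (\<integral>x. f x * \<mu> \<partial>P))"
      using M_int fx_int f_int by simp
    finally show ?case using eq Suc.IH by simp
  qed
  have "(\<integral>\<^sup>+ x. ennreal (stopped (cb_process \<mu> lam) \<tau> x) \<partial>P) = (\<integral>\<^sup>+ x. liminf (\<lambda>n. ennreal (M n x)) \<partial>P)"
  proof (rule nn_integral_cong)
    fix x
    have "eventually (\<lambda>n. ennreal (M n x) = ennreal (stopped (cb_process \<mu> lam) \<tau> x)) sequentially"
      using eventually_ge_at_top[of "\<tau> x"]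
      by eventually_elim (simp add: M_def stopped_def cb_process_restrict min_absorb1)
    then have "(\<lambda>n. ennreal (M n x)) \<longlonglongrightarrow> ennreal (stopped (cb_process \<mu> lam) \<tau> x)"
      by (rule tendsto_eventually)
    then show "ennreal (stopped (cb_process \<mu> lam) \<tau> x) = liminf (\<lambda>n. ennreal (M n x))"
      by (intro lim_imp_Liminf[symmetric]) auto
  qed
  also have "\<dots> \<le> liminf (\<lambda>n. \<integral>\<^sup>+ x. ennreal (M n x) \<partial>P)"
    using M_meas by (intro nn_integral_liminf) auto
  also have "(\<lambda>n. \<integral>\<^sup>+ x. ennreal (M n x) \<partial>P) = (\<lambda>n. 1)"
    using M_int M_nonneg M_expectation by (auto simp: nn_integral_eq_integral intro!: AE_I2 ext)
  finally show "(\<integral>\<^sup>+ x. ennreal (stopped (cb_process \<mu> lam) \<tau> x) \<partial>P) \<le> 1" by (simp add: Liminf_const)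
qed

end

section \<open>One-step extensions and rigidity of betting processes\<close>

lemma prefix_extend:
  assumes "x \<in> space (prefixes t)" "y \<in> Xs"
  shows "x(t := y) \<in> space (prefixes (Suc t))"
  using assms by (auto simp: space_prefixes PiE_def extensional_def Pi_def less_Suc_eq)

lemma cb_process_extend:
  assumes "x \<in> space (prefixes t)"
  shows "cb_process \<mu> lam (Suc t) (x(t := y)) = cb_process \<mu> lam t x * (1 + lam t x * (y - \<mu>))"
proof -
  have "restrict (x(t := y)) {..<s} = restrict x {..<s}" if "s \<le> t" for s
    using that by (auto simp: restrict_def fun_eq_iff)
  moreover have "restrict x {..<t} = x"
    using assms by (auto simp: space_prefixes PiE_def extensional_restrict)
  ultimately show ?thesis by (simp add: cb_process_def)
qed

text \<open>Where the common wealth \<open>c\<close> is zero the bets remain free, so the processes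
  agree but the strategies need not. The induction therefore compares \<open>c * lam t p\<close>
  with \<open>c * lam' t p\<close>: outcome 0 gives one inequality and outcome 1 the
  reverse.\<close>

lemma cb_process_majorises_eq:
  assumes "lam \<in> Lambda_mu Xs \<mu>" "lam' \<in> Lambda_mu Xs \<mu>"
    and maj: "majorises Xs (cb_process \<mu> lam') (cb_process \<mu> lam)"
    and "x \<in> space (prefixes t)"
  shows "cb_process \<mu> lam' t x = cb_process \<mu> lam t x"
  using assms(4)
proof (induction t arbitrary: x)
  case 0
  show ?case by (simp add: cb_process_def)
next
  case (Suc t)
  define p where "p = restrict x {..<t}"
  have p: "p \<in> space (prefixes t)" using Suc.prems by (auto simp: p_def intro: prefix_prefix_in_space)
  have x: "x = p(t := x t)"
    using Suc.prems by (auto simp: p_def space_prefixes PiE_def extensional_def fun_eq_iff restrict_def less_Suc_eq)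
  define c where "c = cb_process \<mu> lam t p"
  have c: "cb_process \<mu> lam' t p = c" using Suc.IH[OF p] by (simp add: c_def)
  have "c \<ge> 0" using cb_process_nonneg[OF assms(1) p] by (simp add: c_def)
  have le: "c * (1 + lam t p * (y - \<mu>)) \<le> c * (1 + lam' t p * (y - \<mu>))" if "y \<in> Xs" for y
    using maj prefix_extend[OF p that] cb_process_extend[OF p] c unfolding majorises_def c_def by metis
  have "c * lam t p * \<mu> \<ge> c * lam' t p * \<mu>" using le[OF zero_in] by (simp add: algebra_simps)
  then have 1: "c * lam' t p \<le> c * lam t p" using mu_pos by (rule mult_right_le_imp_le)
  have "c * lam t p * (1 - \<mu>) \<le> c * lam' t p * (1 - \<mu>)" using le[OF one_in] by (simp add: algebra_simps)
  then have "c * lam t p \<le> c * lam' t p" by (rule mult_right_le_imp_le) (use mu_less in simp)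
  with 1 have "c * lam' t p = c * lam t p" by simp
  then have "c * (1 + lam' t p * (x t - \<mu>)) = c * (1 + lam t p * (x t - \<mu>))"
    by (simp add: distrib_left mult.assoc[symmetric])
  then show ?case using cb_process_extend[OF p] x c c_def by metis
qed

section \<open>Two-point trees\<close>

text \<open>Only times from \<open>t\<close> on are constrained, so such a law may be concentrated
  on one prefix of length \<open>t\<close>. Testing against past events instead of taking
  conditional expectations makes the identity linear in \<open>P\<close>, which suits
  mixtures.\<close>

definition mean_from :: "nat \<Rightarrow> (nat \<Rightarrow> real) measure \<Rightarrow> bool" where
  "mean_from t P \<longleftrightarrow> prob_space P \<and> sets P = sets seqs \<and>
     (\<forall>s\<ge>t. \<forall>A\<in>sets (past s). (\<integral>\<^sup>+ \<omega>. ennreal (\<omega> s) * indicator A \<omega> \<partial>P) = ennreal \<mu> * emeasure P A)"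

lemma mean_from_0_H_mu:
  assumes "mean_from 0 P"
  shows "P \<in> H_mu Xs \<mu>"
proof -
  have setsP: "sets P = sets seqs" and pP: "prob_space P"
    and eq: "\<And>s A. A \<in> sets (past s) \<Longrightarrow> (\<integral>\<^sup>+ \<omega>. ennreal (\<omega> s) * indicator A \<omega> \<partial>P) = ennreal \<mu> * emeasure P A"
    using assms by (auto simp: mean_from_def)
  interpret P: prob_space P by (rule pP)
  have spaceP: "space P = space seqs" using setsP by (rule sets_eq_imp_space_eq)
  have measP: "measurable P = measurable seqs" using setsP by (intro ext measurable_cong_sets) auto
  have "AE x in P. real_cond_exp P (past t) (\<lambda>y. y t) x = \<mu>" for t
  proof -
    interpret sub: finite_measure_subalgebra P "past t"
      by (intro finite_measure_subalgebra.intro finite_measure_subalgebra_axioms.intro P.finite_measure_axioms)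
        (use past_subset setsP spaceP in \<open>auto simp: subalgebra_def\<close>)
    have unit: "0 \<le> x t \<and> x t \<le> 1" if "x \<in> space P" for x
      using that spaceP coord_in_unit by (auto simp: space_seqs)
    have meas: "(\<lambda>x. x t) \<in> borel_measurable P" unfolding measP by (rule measurable_coord)
    show ?thesis
    proof (rule sub.real_cond_exp_charact)
      fix A assume A: "A \<in> sets (past t)"
      then have AP: "A \<in> sets P" using past_subset setsP by auto
      have "(\<integral>\<omega>\<in>A. \<omega> t \<partial>P) = enn2real (\<integral>\<^sup>+ \<omega>. ennreal (indicator A \<omega> * \<omega> t) \<partial>P)"
        unfolding set_lebesgue_integral_def real_scaleR_def
        by (rule integral_eq_nn_integral) (use AP meas unit in \<open>auto intro!: AE_I2\<close>)
      also have "(\<integral>\<^sup>+ \<omega>. ennreal (indicator A \<omega> * \<omega> t) \<partial>P) = (\<integral>\<^sup>+ \<omega>. ennreal (\<omega> t) * indicator A \<omega> \<partial>P)"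
        by (intro nn_integral_cong) (auto simp: indicator_def)
      also have "\<dots> = ennreal \<mu> * emeasure P A" by (rule eq[OF A])
      also have "enn2real \<dots> = \<mu> * measure P A"
        using mu_pos by (simp add: enn2real_mult measure_def)
      also have "\<dots> = (\<integral>\<omega>\<in>A. \<mu> \<partial>P)"
        using AP by (simp add: set_lebesgue_integral_def mult.commute)
      finally show "(\<integral>\<omega>\<in>A. \<omega> t \<partial>P) = (\<integral>\<omega>\<in>A. \<mu> \<partial>P)" .
    next
      show "integrable P (\<lambda>\<omega>. \<omega> t)"
        using unit meas by (intro P.integrable_const_bound[where B = 1]) (auto intro!: AE_I2)
    qed auto
  qed
  then show ?thesis
    using setsP pP filt_eq_past[OF setsP] by (simp add: H_mu_def)
qed

section \<open>Building laws: independent outcomes, prescribed prefixes, mixtures\<close>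

definition bernoulli_coord :: "real measure" where
  "bernoulli_coord = distr (measure_pmf (bernoulli_pmf \<mu>)) (coord_space Xs) of_bool"

lemma of_bool_measurable: "of_bool \<in> measure_pmf (bernoulli_pmf \<mu>) \<rightarrow>\<^sub>M coord_space Xs"
  using zero_in one_in by (auto simp: space_coord)

lemma prob_space_bernoulli_coord: "prob_space bernoulli_coord"
  unfolding bernoulli_coord_def by (intro measure_pmf.prob_space_distr of_bool_measurable)

lemma sets_bernoulli_coord: "sets bernoulli_coord = sets (coord_space Xs)"
  by (simp add: bernoulli_coord_def)

lemma space_bernoulli_coord: "space bernoulli_coord = Xs"
  by (simp add: bernoulli_coord_def space_coord)

lemma mean_bernoulli_coord: "(\<integral>\<^sup>+ y. ennreal y \<partial>bernoulli_coord) = ennreal \<mu>"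
  unfolding bernoulli_coord_def
  using measurable_coord_borel mu_pos mu_less
  by (subst nn_integral_distr[OF of_bool_measurable]) auto

text \<open>Independent outcomes in {0, 1} with mean \<mu> work. An event of the past of
  \<open>s\<close> does not see coordinate \<open>s\<close>, so splitting that coordinate off the
  product factorises the integral.\<close>

lemma mean_from_0_exists: "\<exists>Q. mean_from 0 Q"
proof (intro exI)
  define Q where "Q = PiM UNIV (\<lambda>_::nat. bernoulli_coord)"
  have setsQ: "sets Q = sets seqs"
    unfolding Q_def seq_space_def by (intro sets_PiM_cong sets_bernoulli_coord refl)
  show "mean_from 0 Q"
    unfolding mean_from_def
  proof (intro conjI allI impI ballI setsQ)
    show "prob_space Q" unfolding Q_def by (intro prob_space_PiM prob_space_bernoulli_coord)
  next
    fix s A assume A: "A \<in> sets (past s)"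
    define R where "R = PiM (UNIV - {s}) (\<lambda>_::nat. bernoulli_coord)"
    interpret R: prob_space R unfolding R_def by (intro prob_space_PiM prob_space_bernoulli_coord)
    interpret B: prob_space bernoulli_coord by (rule prob_space_bernoulli_coord)
    define \<phi> :: "real \<times> (nat \<Rightarrow> real) \<Rightarrow> nat \<Rightarrow> real" where "\<phi> = (\<lambda>(y, X). X(s := y))"
    have "insert s (UNIV - {s}) = UNIV" by auto
    then have Q: "Q = distr (bernoulli_coord \<Otimes>\<^sub>M R) Q \<phi>"
      using distr_pair_PiM_eq_PiM[of "UNIV - {s}" "\<lambda>_. bernoulli_coord" s] prob_space_bernoulli_coord
      unfolding Q_def R_def \<phi>_def by simp
    have \<phi>_meas: "\<phi> \<in> bernoulli_coord \<Otimes>\<^sub>M R \<rightarrow>\<^sub>M Q"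
    proof -
      have "(\<lambda>p. (snd p)(s := fst p)) \<in> bernoulli_coord \<Otimes>\<^sub>M R \<rightarrow>\<^sub>M Q"
        unfolding Q_def R_def by (rule measurable_fun_upd[where J = "UNIV - {s}"]) auto
      then show ?thesis by (simp add: \<phi>_def split_beta')
    qed
    \<comment> \<open>The value 0 at coordinate \<open>s\<close> is a placeholder, invisible to
      \<open>A\<close>. The factorisation below is used twice, with the constant 1 to identify
      \<open>C\<close> as the mass of \<open>A\<close>, and with the outcome itself.\<close>
    define C where "C = (\<integral>\<^sup>+ X. indicator A (X(s := 0)) \<partial>R)"
    have ind: "indicator A (\<phi> (y, X)) = (indicator A (X(s := 0)) :: ennreal)" if "y \<in> Xs" "X \<in> space R" for y X
    proof -
      have sp: "X(s := z) \<in> space seqs" if "z \<in> Xs" for z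
        using that \<open>X \<in> space R\<close> by (auto simp: R_def space_PiM space_bernoulli_coord space_seqs)
      moreover have "restrict (X(s := z)) {..<s} = restrict X {..<s}" for z
        by (auto simp: restrict_def fun_eq_iff)
      ultimately have "X(s := y) \<in> A \<longleftrightarrow> X(s := 0) \<in> A"
        using A that(1) zero_in by (auto simp: sets_past)
      then show ?thesis by (simp add: \<phi>_def indicator_def)
    qed
    have fac: "(\<integral>\<^sup>+ \<omega>. f (\<omega> s) * indicator A \<omega> \<partial>Q) = (\<integral>\<^sup>+ y. f y \<partial>bernoulli_coord) * C"
      if f: "f \<in> borel_measurable borel" for f :: "real \<Rightarrow> ennreal"
    proof -
      have "A \<in> sets Q" using A past_subset setsQ by auto
      moreover have "(\<lambda>\<omega>. f (\<omega> s)) \<in> borel_measurable Q"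
        using measurable_compose[OF measurable_coord f] setsQ measurable_cong_sets by blast
      ultimately have m: "(\<lambda>\<omega>. f (\<omega> s) * indicator A \<omega>) \<in> borel_measurable Q"
        by (intro borel_measurable_times_ennreal borel_measurable_indicator)
      have fB: "f \<in> borel_measurable bernoulli_coord"
        using measurable_compose[OF measurable_coord_borel f] sets_bernoulli_coord measurable_cong_sets by blast
      have "(\<integral>\<^sup>+ \<omega>. f (\<omega> s) * indicator A \<omega> \<partial>Q) = (\<integral>\<^sup>+ p. f (\<phi> p s) * indicator A (\<phi> p) \<partial>(bernoulli_coord \<Otimes>\<^sub>M R))"
        by (subst Q) (rule nn_integral_distr, use \<phi>_meas m in simp_all)
      also have "\<dots> = (\<integral>\<^sup>+ y. \<integral>\<^sup>+ X. f (\<phi> (y, X) s) * indicator A (\<phi> (y, X)) \<partial>R \<partial>bernoulli_coord)"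
        by (rule R.nn_integral_fst[symmetric]) (rule measurable_compose[OF \<phi>_meas m])
      also have "\<dots> = (\<integral>\<^sup>+ y. \<integral>\<^sup>+ X. f y * indicator A (X(s := 0)) \<partial>R \<partial>bernoulli_coord)"
        by (intro nn_integral_cong) (use ind in \<open>simp add: space_bernoulli_coord\<close>, simp add: \<phi>_def)
      also have "\<dots> = (\<integral>\<^sup>+ y. f y * C \<partial>bernoulli_coord)"
      proof (intro nn_integral_cong)
        fix y
        have "(\<lambda>X. \<phi> (0, X)) \<in> R \<rightarrow>\<^sub>M Q"
          using zero_in by (intro measurable_compose[OF _ \<phi>_meas] measurable_Pair1') (simp add: space_bernoulli_coord)
        then have "(\<lambda>X. indicator A (X(s := 0)) :: ennreal) \<in> borel_measurable R"
          using measurable_compose[OF _ borel_measurable_indicator[OF \<open>A \<in> sets Q\<close>]] by (simp add: \<phi>_def)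
        then show "(\<integral>\<^sup>+ X. f y * indicator A (X(s := 0)) \<partial>R) = f y * C"
          unfolding C_def by (rule nn_integral_cmult)
      qed
      also have "\<dots> = (\<integral>\<^sup>+ y. f y \<partial>bernoulli_coord) * C"
        using fB by (rule nn_integral_multc)
      finally show ?thesis .
    qed
    have "A \<in> sets Q" using A past_subset setsQ by auto
    then have "emeasure Q A = C"
      using fac[of "\<lambda>_. 1"] B.emeasure_space_1 by simp
    then show "(\<integral>\<^sup>+ \<omega>. ennreal (\<omega> s) * indicator A \<omega> \<partial>Q) = ennreal \<mu> * emeasure Q A"
      using fac[of ennreal] mean_bernoulli_coord by simp
  qed
qed

lemma measurable_past_coord_space: "i < s \<Longrightarrow> (\<lambda>\<omega>. \<omega> i) \<in> past s \<rightarrow>\<^sub>M coord_space Xs"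
proof -
  assume i: "i < s"
  have "(\<lambda>\<omega>. restrict \<omega> {..<s}) \<in> past s \<rightarrow>\<^sub>M prefixes s"
    unfolding filt_def by (intro measurable_vimage_algebra1 funcsetI prefix_in_space)
  moreover have "(\<lambda>x. x i) \<in> prefixes s \<rightarrow>\<^sub>M coord_space Xs"
    unfolding prefix_space_def using i by (intro measurable_component_singleton) auto
  ultimately have "(\<lambda>\<omega>. restrict \<omega> {..<s} i) \<in> past s \<rightarrow>\<^sub>M coord_space Xs"
    by (rule measurable_compose)
  then show ?thesis using i by simp
qed

lemma measurable_coord_space: "(\<lambda>\<omega>. \<omega> i) \<in> seqs \<rightarrow>\<^sub>M coord_space Xs"
  unfolding seq_space_def by (rule measurable_component_singleton) simp

text \<open>The first \<open>t\<close> coordinates of a mean-\<mu> sequence are overwritten by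
  \<open>x\<close>. This map pulls past events back to past events and leaves coordinates from
  \<open>t\<close> on untouched, so the identities at those times carry over.\<close>

lemma mean_from_after_prefix:
  assumes x: "x \<in> space (prefixes t)"
  shows "\<exists>P. mean_from t P \<and> (AE \<omega> in P. restrict \<omega> {..<t} = x)"
proof -
  obtain Q where Q: "mean_from 0 Q" using mean_from_0_exists by blast
  have setsQ: "sets Q = sets seqs" and pQ: "prob_space Q"
    and eq: "\<And>s A. A \<in> sets (past s) \<Longrightarrow> (\<integral>\<^sup>+ \<omega>. ennreal (\<omega> s) * indicator A \<omega> \<partial>Q) = ennreal \<mu> * emeasure Q A"
    using Q by (auto simp: mean_from_def)
  have spaceQ: "space Q = space seqs" using setsQ by (rule sets_eq_imp_space_eq)
  have measQ: "measurable Q = measurable seqs" using setsQ by (intro ext measurable_cong_sets) auto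
  define \<phi> where "\<phi> = (\<lambda>\<omega> i. if i < t then x i else \<omega> i :: real)"
  have xi: "x i \<in> Xs" if "i < t" for i using x that by (auto simp: space_prefixes)
  have \<phi>_space: "\<phi> \<omega> \<in> space seqs" if "\<omega> \<in> space seqs" for \<omega>
    using that xi by (auto simp: \<phi>_def space_seqs)
  have \<phi>_coord: "(\<lambda>\<omega>. \<phi> \<omega> i) \<in> M \<rightarrow>\<^sub>M coord_space Xs" if "(\<lambda>\<omega>. \<omega> i) \<in> M \<rightarrow>\<^sub>M coord_space Xs" for M i
    using that xi[of i] by (cases "i < t") (simp_all add: \<phi>_def space_coord)
  have \<phi>_meas: "\<phi> \<in> Q \<rightarrow>\<^sub>M seqs"
  proof -
    have "(\<lambda>\<omega> i. \<phi> \<omega> i) \<in> seqs \<rightarrow>\<^sub>M PiM UNIV (\<lambda>_. coord_space Xs)"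
      by (intro measurable_PiM_single' \<phi>_coord measurable_coord_space)
        (use \<phi>_space in \<open>auto simp: space_coord space_seqs\<close>)
    then show ?thesis unfolding measQ seq_space_def by simp
  qed
  have \<phi>_past: "\<phi> \<in> past s \<rightarrow>\<^sub>M past s" for s
  proof -
    have "(\<lambda>\<omega>. restrict (\<phi> \<omega>) {..<s}) \<in> past s \<rightarrow>\<^sub>M prefixes s"
      unfolding prefix_space_def
      by (intro measurable_restrict \<phi>_coord measurable_past_coord_space) simp
    then show ?thesis
      unfolding filt_def[of Xs seqs s] using \<phi>_space
      by (intro measurable_vimage_algebra2) auto
  qed
  define P where "P = distr Q seqs \<phi>"
  have nn: "(\<integral>\<^sup>+ \<omega>. f \<omega> \<partial>P) = (\<integral>\<^sup>+ \<omega>. f (\<phi> \<omega>) \<partial>Q)" if "f \<in> borel_measurable seqs" for f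
    unfolding P_def using \<phi>_meas that by (intro nn_integral_distr) simp_all
  have "mean_from t P"
    unfolding mean_from_def
  proof (intro conjI allI impI ballI)
    show "prob_space P" unfolding P_def using pQ \<phi>_meas by (rule prob_space.prob_space_distr)
    show "sets P = sets seqs" by (simp add: P_def)
    fix s A assume s: "t \<le> s" and A: "A \<in> sets (past s)"
    have A': "A \<in> sets seqs" using A past_subset by auto
    define A\<phi> where "A\<phi> = \<phi> -` A \<inter> space seqs"
    have A\<phi>: "A\<phi> \<in> sets (past s)"
      using measurable_sets[OF \<phi>_past A] by (simp add: A\<phi>_def)
    have "(\<integral>\<^sup>+ \<omega>. ennreal (\<omega> s) * indicator A \<omega> \<partial>P) = (\<integral>\<^sup>+ \<omega>. ennreal (\<phi> \<omega> s) * indicator A (\<phi> \<omega>) \<partial>Q)"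
      using A' measurable_coord[of s] by (intro nn) (intro borel_measurable_times_ennreal measurable_compose[OF _ measurable_ennreal] borel_measurable_indicator)
    also have "\<dots> = (\<integral>\<^sup>+ \<omega>. ennreal (\<omega> s) * indicator A\<phi> \<omega> \<partial>Q)"
      using s by (intro nn_integral_cong) (auto simp: \<phi>_def A\<phi>_def spaceQ indicator_def)
    also have "\<dots> = ennreal \<mu> * emeasure Q A\<phi>" by (rule eq[OF A\<phi>])
    also have "emeasure Q A\<phi> = emeasure P A"
      unfolding P_def A\<phi>_def using emeasure_distr[OF \<phi>_meas A'] spaceQ by simp
    finally show "(\<integral>\<^sup>+ \<omega>. ennreal (\<omega> s) * indicator A \<omega> \<partial>P) = ennreal \<mu> * emeasure P A" .
  qed
  moreover have "AE \<omega> in P. restrict \<omega> {..<t} = x"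
  proof -
    have "restrict (\<phi> \<omega>) {..<t} = x" for \<omega>
      using x by (auto simp: \<phi>_def space_prefixes PiE_iff extensional_def restrict_def fun_eq_iff)
    moreover have "restrict \<omega> {..<t} = x \<longleftrightarrow> (\<forall>i<t. \<omega> i = x i)" for \<omega>
      using x by (auto simp: space_prefixes PiE_iff extensional_def restrict_def fun_eq_iff)
    moreover have "Measurable.pred seqs (\<lambda>\<omega>. \<forall>i<t. \<omega> i = x i)" by measurable
    ultimately show ?thesis
      unfolding P_def using \<phi>_meas by (subst AE_distr_iff) (auto simp: pred_def)
  qed
  ultimately show ?thesis by blast
qed

text \<open>After time \<open>t\<close> the mean identities are linear in the law. At time
  \<open>t\<close> a past event has probability 0 or 1, the same under both components, since both
  follow \<open>x\<close>; the identity then reduces to \<open>p * y + (1 - p) * z = \<mu>\<close>.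
  The formula for integrals is part of the conclusion because expected stopped values have to be
  mixed as well.\<close>

lemma mean_from_mixture:
  assumes Py: "mean_from (Suc t) Py" "AE \<omega> in Py. restrict \<omega> {..<Suc t} = x(t := y)"
    and Pz: "mean_from (Suc t) Pz" "AE \<omega> in Pz. restrict \<omega> {..<Suc t} = x(t := z)"
    and x: "x \<in> space (prefixes t)" and p: "0 \<le> p" "p \<le> 1" "p * y + (1 - p) * z = \<mu>"
    and yz: "y \<in> Xs" "z \<in> Xs"
  shows "\<exists>P. mean_from t P \<and> (AE \<omega> in P. restrict \<omega> {..<t} = x) \<and>
    (\<forall>f\<in>borel_measurable seqs. (\<integral>\<^sup>+ \<omega>. f \<omega> \<partial>P) = (\<integral>\<^sup>+ \<omega>. f \<omega> \<partial>Py) * ennreal p + (\<integral>\<^sup>+ \<omega>. f \<omega> \<partial>Pz) * ennreal (1 - p))"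
proof -
  have setsPy: "sets Py = sets seqs" and pPy: "prob_space Py"
    and eqy: "\<And>s A. Suc t \<le> s \<Longrightarrow> A \<in> sets (past s) \<Longrightarrow> (\<integral>\<^sup>+ \<omega>. ennreal (\<omega> s) * indicator A \<omega> \<partial>Py) = ennreal \<mu> * emeasure Py A"
    using Py(1) by (auto simp: mean_from_def)
  have setsPz: "sets Pz = sets seqs" and pPz: "prob_space Pz"
    and eqz: "\<And>s A. Suc t \<le> s \<Longrightarrow> A \<in> sets (past s) \<Longrightarrow> (\<integral>\<^sup>+ \<omega>. ennreal (\<omega> s) * indicator A \<omega> \<partial>Pz) = ennreal \<mu> * emeasure Pz A"
    using Pz(1) by (auto simp: mean_from_def)
  define N where "N b = (if b then Py else Pz)" for b
  define P where "P = measure_pmf (bernoulli_pmf p) \<bind> N"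
  have N: "N \<in> measure_pmf (bernoulli_pmf p) \<rightarrow>\<^sub>M subprob_algebra seqs"
    using setsPy pPy setsPz pPz by (auto simp: N_def space_subprob_algebra prob_space_imp_subprob_space)
  have setsP: "sets P = sets seqs" unfolding P_def by (rule sets_bind) (use setsPy setsPz in \<open>auto simp: N_def\<close>)
  have nn: "(\<integral>\<^sup>+ \<omega>. f \<omega> \<partial>P) = (\<integral>\<^sup>+ \<omega>. f \<omega> \<partial>Py) * ennreal p + (\<integral>\<^sup>+ \<omega>. f \<omega> \<partial>Pz) * ennreal (1 - p)"
    if "f \<in> borel_measurable seqs" for f
    unfolding P_def using nn_integral_bind[OF that N] p by (simp add: N_def)
  have em: "emeasure P A = emeasure Py A * ennreal p + emeasure Pz A * ennreal (1 - p)" if "A \<in> sets seqs" for A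
    using nn[OF borel_measurable_indicator[OF that]] that setsP setsPy setsPz by simp
  have prefix_x: "restrict \<omega> {..<t} = x" if "restrict \<omega> {..<Suc t} = x(t := u)" for \<omega> u
  proof (rule ext)
    fix i show "restrict \<omega> {..<t} i = x i"
      using fun_cong[OF that, of i] x by (cases "i < t") (auto simp: space_prefixes PiE_iff extensional_def)
  qed
  have coord_u: "\<omega> t = u" if "restrict \<omega> {..<Suc t} = x(t := u)" for \<omega> u
    using fun_cong[OF that, of t] by simp
  have mP: "mean_from t P"
    unfolding mean_from_def
  proof (intro conjI allI impI ballI setsP)
    show "prob_space P"
      unfolding P_def by (rule measure_pmf.prob_space_bind[OF _ N]) (use pPy pPz in \<open>simp add: N_def\<close>)
    fix s A assume s: "t \<le> s" and A: "A \<in> sets (past s)"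
    have A': "A \<in> sets seqs" using A past_subset by auto
    have m: "(\<lambda>\<omega>. ennreal (\<omega> s) * indicator A \<omega>) \<in> borel_measurable seqs"
      using A' measurable_coord[of s]
      by (intro borel_measurable_times_ennreal measurable_compose[OF _ measurable_ennreal] borel_measurable_indicator)
    show "(\<integral>\<^sup>+ \<omega>. ennreal (\<omega> s) * indicator A \<omega> \<partial>P) = ennreal \<mu> * emeasure P A"
    proof (cases "s = t")
      case False
      then have "Suc t \<le> s" using s by simp
      then show ?thesis
        using eqy[OF _ A] eqz[OF _ A] nn[OF m] em[OF A'] by (simp add: distrib_left mult.assoc)
    next
      case True
      obtain B where B: "A = (\<lambda>\<omega>. restrict \<omega> {..<t}) -` B \<inter> space seqs"
        using A True by (auto simp: sets_past)
      have dirac: "(\<integral>\<^sup>+ \<omega>. ennreal (\<omega> t) * indicator A \<omega> \<partial>R) = ennreal u * indicator B x" "emeasure R A = indicator B x"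
        if R: "prob_space R" "sets R = sets seqs" "AE \<omega> in R. restrict \<omega> {..<Suc t} = x(t := u)" for R u
      proof -
        interpret R: prob_space R by fact
        have spaceR: "space R = space seqs" using R(2) by (rule sets_eq_imp_space_eq)
        have ae: "AE \<omega> in R. indicator A \<omega> = (indicator B x :: ennreal) \<and> \<omega> t = u"
          using R(3) AE_space by eventually_elim (use prefix_x coord_u in \<open>auto simp: B indicator_def spaceR\<close>)
        then have "(\<integral>\<^sup>+ \<omega>. ennreal (\<omega> t) * indicator A \<omega> \<partial>R) = (\<integral>\<^sup>+ \<omega>. ennreal u * indicator B x \<partial>R)"
          by (intro nn_integral_cong_AE) auto
        then show "(\<integral>\<^sup>+ \<omega>. ennreal (\<omega> t) * indicator A \<omega> \<partial>R) = ennreal u * indicator B x"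
          by (simp add: R.emeasure_space_1)
        have "emeasure R A = (\<integral>\<^sup>+ \<omega>. indicator A \<omega> \<partial>R)" using A' R(2) by simp
        also have "\<dots> = (\<integral>\<^sup>+ \<omega>. indicator B x \<partial>R)" using ae by (intro nn_integral_cong_AE) auto
        finally show "emeasure R A = indicator B x" by (simp add: R.emeasure_space_1)
      qed
      have "0 \<le> y" "0 \<le> z" using yz coord_in_unit by auto
      then have "ennreal y * ennreal p + ennreal z * ennreal (1 - p) = ennreal \<mu>"
        using p by (simp add: ennreal_mult[symmetric] ennreal_plus[symmetric] mult.commute del: ennreal_plus)
      moreover have "ennreal p + ennreal (1 - p) = 1"
        using p by (simp add: ennreal_plus[symmetric] del: ennreal_plus)
      ultimately show ?thesis
        using nn[OF m] em[OF A'] True dirac[OF pPy setsPy Py(2)] dirac[OF pPz setsPz Pz(2)]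
        by (auto simp: indicator_def)
    qed
  qed
  have "AE \<omega> in Py. restrict \<omega> {..<t} = x" "AE \<omega> in Pz. restrict \<omega> {..<t} = x"
    using Py(2) Pz(2) by (auto elim: eventually_mono intro: prefix_x)
  then have "AE \<omega> in N b. restrict \<omega> {..<t} = x" for b
    by (cases b) (simp_all only: N_def if_True if_False)
  moreover have "restrict \<omega> {..<t} = x \<longleftrightarrow> (\<forall>i<t. \<omega> i = x i)" for \<omega>
    using x by (auto simp: space_prefixes PiE_iff extensional_def restrict_def fun_eq_iff)
  moreover have "Measurable.pred seqs (\<lambda>\<omega>. \<forall>i<t. \<omega> i = x i)" by measurable
  ultimately have "AE \<omega> in P. restrict \<omega> {..<t} = x"
    unfolding P_def by (subst AE_bind[OF N]) simp_all
  then show ?thesis using mP nn by blast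
qed

section \<open>Coded finite trees, their values, and their realisation by laws and stopping
  times\<close>

definition two_point :: "real \<Rightarrow> real \<Rightarrow> real \<Rightarrow> bool" where
  "two_point p y z \<longleftrightarrow> y \<in> Xs \<and> z \<in> Xs \<and> 0 \<le> p \<and> p \<le> 1 \<and> p * y + (1 - p) * z = \<mu> \<and> (y \<noteq> z \<or> p = 1)"

text \<open>A sequence w codes a finite tree of two-point experiments: either stop at once, or draw the
  next outcome from the mean-\<mu> law with mass w 0 at w 1 and mass 1 - w 0 at w 2 and continue with the
  trees coded by the remaining odd and even entries. If w 1 = w 2, both trees could prescribe different stopping rules after
  the same outcome, so all the mass is then put on the first one.\<close>
primrec tree_value :: "(nat \<Rightarrow> (nat \<Rightarrow> real) \<Rightarrow> real) \<Rightarrow> nat \<Rightarrow> nat \<Rightarrow> (nat \<Rightarrow> real) \<Rightarrow> (nat \<Rightarrow> real) \<Rightarrow> real" where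
  "tree_value E 0 t x w = E t x"
| "tree_value E (Suc n) t x w = (if two_point (w 0) (w 1) (w 2)
     then w 0 * tree_value E n (Suc t) (x(t := w 1)) (\<lambda>k. w (2 * k + 3)) +
       (1 - w 0) * tree_value E n (Suc t) (x(t := w 2)) (\<lambda>k. w (2 * k + 4))
     else E t x)"

definition join_trees :: "real \<Rightarrow> real \<Rightarrow> real \<Rightarrow> (nat \<Rightarrow> real) \<Rightarrow> (nat \<Rightarrow> real) \<Rightarrow> nat \<Rightarrow> real" where
  "join_trees p y z v w k = (if k = 0 then p else if k = 1 then y else if k = 2 then z
     else if odd k then v ((k - 3) div 2) else w ((k - 4) div 2))"

lemma tree_value_join:
  assumes "two_point p y z"
  shows "tree_value E (Suc n) t x (join_trees p y z v w) =
    p * tree_value E n (Suc t) (x(t := y)) v + (1 - p) * tree_value E n (Suc t) (x(t := z)) w"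
proof -
  have "(\<lambda>k. join_trees p y z v w (2 * k + 3)) = v" "(\<lambda>k. join_trees p y z v w (2 * k + 4)) = w"
    by (auto simp: join_trees_def fun_eq_iff)
  then show ?thesis using assms by (simp add: join_trees_def)
qed

text \<open>The entry -1 is not a possible mass, so this code means stopping at once whatever the
  depth.\<close>

lemma tree_value_stop: "tree_value E n t x (\<lambda>_. -1) = E t x"
  by (cases n) (auto simp: two_point_def)

text \<open>The depth is only an upper bound on the number of draws. Padding lets two subtrees of
  different depths be joined under one root.\<close>

lemma tree_value_Suc: "\<exists>v. tree_value E (Suc n) t x v = tree_value E n t x w"
proof (induction n arbitrary: t x w)
  case 0
  show ?case by (rule exI[of _ "\<lambda>_. -1"]) (simp only: tree_value_stop tree_value.simps(1))
next
  case (Suc n)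
  show ?case
  proof (cases "two_point (w 0) (w 1) (w 2)")
    case True
    obtain v1 where v1: "tree_value E (Suc n) (Suc t) (x(t := w 1)) v1 = tree_value E n (Suc t) (x(t := w 1)) (\<lambda>k. w (2 * k + 3))"
      using Suc.IH by blast
    obtain v2 where v2: "tree_value E (Suc n) (Suc t) (x(t := w 2)) v2 = tree_value E n (Suc t) (x(t := w 2)) (\<lambda>k. w (2 * k + 4))"
      using Suc.IH by blast
    have "tree_value E (Suc (Suc n)) t x (join_trees (w 0) (w 1) (w 2) v1 v2) = tree_value E (Suc n) t x w"
      unfolding tree_value_join[OF True] v1 v2 using True by simp
    then show ?thesis by blast
  next
    case False
    then have "tree_value E (Suc (Suc n)) t x (\<lambda>_. -1) = tree_value E (Suc n) t x w"
      unfolding tree_value_stop by simp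
    then show ?thesis by blast
  qed
qed

lemma tree_value_add: "\<exists>v. tree_value E (n + m) t x v = tree_value E n t x w"
proof (induction m)
  case 0
  show ?case by auto
next
  case (Suc m)
  then show ?case using tree_value_Suc[of E "n + m"] by (metis add_Suc_right)
qed

text \<open>Since trees are points of \<open>nat \<Rightarrow> real\<close>, the prefixes with an
  attainable value above a Borel threshold form a countable union of projections of Borel sets. This
  is the form that separation accepts.\<close>

definition attainable :: "(nat \<Rightarrow> (nat \<Rightarrow> real) \<Rightarrow> real) \<Rightarrow> nat \<Rightarrow> (nat \<Rightarrow> real) \<Rightarrow> real \<Rightarrow> bool" where
  "attainable E t x a \<longleftrightarrow> (\<exists>n w. a = tree_value E n t x w)"

lemma attainable_stop: "attainable E t x (E t x)"
  unfolding attainable_def by (intro exI[of _ 0]) simp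

lemma attainable_two_point:
  assumes "two_point p y z" "attainable E (Suc t) (x(t := y)) a" "attainable E (Suc t) (x(t := z)) b"
  shows "attainable E t x (p * a + (1 - p) * b)"
proof -
  obtain n v m w where a: "a = tree_value E n (Suc t) (x(t := y)) v" and b: "b = tree_value E m (Suc t) (x(t := z)) w"
    using assms(2,3) by (auto simp: attainable_def)
  obtain v' where "a = tree_value E (n + m) (Suc t) (x(t := y)) v'"
    using tree_value_add[of E n m] a by metis
  moreover obtain w' where "b = tree_value E (n + m) (Suc t) (x(t := z)) w'"
    using tree_value_add[of E m n] b by (metis add.commute)
  ultimately have "p * a + (1 - p) * b = tree_value E (Suc (n + m)) t x (join_trees p y z v' w')"
    using tree_value_join[OF assms(1)] by simp
  then show ?thesis unfolding attainable_def by blast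
qed

text \<open>For a mixture, the outcome at time \<open>t\<close> tells which subtree is being
  followed and hence which stopping rule to obey. This is admissible because both rules stop at
  \<open>Suc t\<close> or later, which is why the lower bound on \<open>\<tau>\<close> is carried
  along. Mixing preserves only an inequality, as \<open>ennreal\<close> cuts negative numbers to
  0.\<close>

lemma tree_value_expectation:
  assumes E: "\<And>t. E t \<in> borel_measurable (prefixes t)"
    and x: "x \<in> space (prefixes t)"
  shows "\<exists>P \<tau>. mean_from t P \<and> (AE \<omega> in P. restrict \<omega> {..<t} = x) \<and> finite_stopping_time Xs \<tau> \<and>
    (\<forall>\<omega>\<in>space seqs. t \<le> \<tau> \<omega>) \<and> ennreal (tree_value E n t x w) \<le> (\<integral>\<^sup>+ \<omega>. ennreal (stopped E \<tau> \<omega>) \<partial>P)"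
  using x
proof (induction n arbitrary: t x w)
  have stop: "\<exists>P \<tau>. mean_from t P \<and> (AE \<omega> in P. restrict \<omega> {..<t} = x) \<and> finite_stopping_time Xs \<tau> \<and>
    (\<forall>\<omega>\<in>space seqs. t \<le> \<tau> \<omega>) \<and> ennreal (E t x) \<le> (\<integral>\<^sup>+ \<omega>. ennreal (stopped E \<tau> \<omega>) \<partial>P)"
    if x: "x \<in> space (prefixes t)" for t x
  proof -
    obtain P where P: "mean_from t P" "AE \<omega> in P. restrict \<omega> {..<t} = x"
      using mean_from_after_prefix[OF x] by blast
    interpret P: prob_space P using P(1) by (simp add: mean_from_def)
    have "finite_stopping_time Xs (\<lambda>_. t)"
      unfolding finite_stopping_time_def
    proof
      fix s show "{x \<in> space seqs. t = s} \<in> sets (past s)"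
        using sets.top[of "past s"] by (cases "t = s") auto
    qed
    moreover have "(\<integral>\<^sup>+ \<omega>. ennreal (stopped E (\<lambda>_. t) \<omega>) \<partial>P) = (\<integral>\<^sup>+ \<omega>. ennreal (E t x) \<partial>P)"
      using P(2) by (intro nn_integral_cong_AE) (auto simp: stopped_def)
    then have "ennreal (E t x) \<le> (\<integral>\<^sup>+ \<omega>. ennreal (stopped E (\<lambda>_. t) \<omega>) \<partial>P)"
      by (simp add: P.emeasure_space_1)
    ultimately show ?thesis using P by (intro exI[of _ P] exI[of _ "\<lambda>_. t"]) auto
  qed
  {
    case 0
    show ?case using stop[OF 0] by (simp only: tree_value.simps)
  next
    case (Suc n)
    show ?case
    proof (cases "two_point (w 0) (w 1) (w 2)")
      case False
      then show ?thesis using stop[OF Suc.prems] by (simp only: tree_value.simps if_False)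
    next
      case True
      define p y z where "p = w 0" and "y = w 1" and "z = w 2"
      define a b where "a = tree_value E n (Suc t) (x(t := y)) (\<lambda>k. w (2 * k + 3))"
        and "b = tree_value E n (Suc t) (x(t := z)) (\<lambda>k. w (2 * k + 4))"
      have p: "0 \<le> p" "p \<le> 1" "p * y + (1 - p) * z = \<mu>" and yz: "y \<in> Xs" "z \<in> Xs" "y \<noteq> z \<or> p = 1"
        using True by (auto simp: two_point_def p_def y_def z_def)
      have tree: "tree_value E (Suc n) t x w = p * a + (1 - p) * b"
        using True by (simp add: p_def y_def z_def a_def b_def)
      obtain Py \<tau>y where Py: "mean_from (Suc t) Py" "AE \<omega> in Py. restrict \<omega> {..<Suc t} = x(t := y)"
          and \<tau>y: "finite_stopping_time Xs \<tau>y" "\<And>\<omega>. \<omega> \<in> space seqs \<Longrightarrow> Suc t \<le> \<tau>y \<omega>"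
          and a: "ennreal a \<le> (\<integral>\<^sup>+ \<omega>. ennreal (stopped E \<tau>y \<omega>) \<partial>Py)"
        using Suc.IH[OF prefix_extend[OF Suc.prems yz(1)], of "\<lambda>k. w (2 * k + 3)"] unfolding a_def by blast
      obtain Pz \<tau>z where Pz: "mean_from (Suc t) Pz" "AE \<omega> in Pz. restrict \<omega> {..<Suc t} = x(t := z)"
          and \<tau>z: "finite_stopping_time Xs \<tau>z" "\<And>\<omega>. \<omega> \<in> space seqs \<Longrightarrow> Suc t \<le> \<tau>z \<omega>"
          and b: "ennreal b \<le> (\<integral>\<^sup>+ \<omega>. ennreal (stopped E \<tau>z \<omega>) \<partial>Pz)"
        using Suc.IH[OF prefix_extend[OF Suc.prems yz(2)], of "\<lambda>k. w (2 * k + 4)"] unfolding b_def by blast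
      obtain P where P: "mean_from t P" "AE \<omega> in P. restrict \<omega> {..<t} = x"
        and mix: "\<And>f. f \<in> borel_measurable seqs \<Longrightarrow>
          (\<integral>\<^sup>+ \<omega>. f \<omega> \<partial>P) = (\<integral>\<^sup>+ \<omega>. f \<omega> \<partial>Py) * ennreal p + (\<integral>\<^sup>+ \<omega>. f \<omega> \<partial>Pz) * ennreal (1 - p)"
        using mean_from_mixture[OF Py Pz Suc.prems p yz(1,2)] by blast
      define \<tau> where "\<tau> \<omega> = (if \<omega> t = y then \<tau>y \<omega> else \<tau>z \<omega>)" for \<omega>
      have \<tau>_ge: "Suc t \<le> \<tau> \<omega>" if "\<omega> \<in> space seqs" for \<omega>
        using that \<tau>y(2) \<tau>z(2) by (simp add: \<tau>_def)
      have \<tau>: "finite_stopping_time Xs \<tau>"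
        unfolding finite_stopping_time_def
      proof
        fix s
        show "{\<omega> \<in> space seqs. \<tau> \<omega> = s} \<in> sets (past s)"
        proof (cases "t < s")
          case True
          have "{\<omega> \<in> space (past s). \<omega> t = y} \<in> sets (past s)"
            using measurable_compose[OF measurable_past_coord_space[OF True] measurable_coord_borel] by measurable
          then have "{\<omega> \<in> space seqs. \<omega> t = y} \<in> sets (past s)" by simp
          moreover have "{\<omega> \<in> space seqs. \<tau> \<omega> = s} =
              ({\<omega> \<in> space seqs. \<omega> t = y} \<inter> {\<omega> \<in> space seqs. \<tau>y \<omega> = s}) \<union>
              ({\<omega> \<in> space seqs. \<tau>z \<omega> = s} - {\<omega> \<in> space seqs. \<omega> t = y})"
            by (auto simp: \<tau>_def)
          ultimately show ?thesis
            using stopping_time_eq[OF \<tau>y(1)] stopping_time_eq[OF \<tau>z(1)]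
            by (simp only:) (intro sets.Un sets.Int sets.Diff)
        next
          case False
          then have "{\<omega> \<in> space seqs. \<tau> \<omega> = s} = {}" using \<tau>_ge by fastforce
          then show ?thesis by (simp only: sets.empty_sets)
        qed
      qed
      have coord: "\<omega> t = u" if "restrict \<omega> {..<Suc t} = x(t := u)" for \<omega> u
        using fun_cong[OF that, of t] by simp
      have "(\<integral>\<^sup>+ \<omega>. ennreal (stopped E \<tau> \<omega>) \<partial>Py) = (\<integral>\<^sup>+ \<omega>. ennreal (stopped E \<tau>y \<omega>) \<partial>Py)"
        using Py(2) by (intro nn_integral_cong_AE) (auto elim!: eventually_mono dest: coord simp: stopped_def \<tau>_def)
      then have a': "ennreal a * ennreal p \<le> (\<integral>\<^sup>+ \<omega>. ennreal (stopped E \<tau> \<omega>) \<partial>Py) * ennreal p"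
        using a by (simp add: mult_right_mono)
      \<comment> \<open>With \<open>p < 1\<close> the outcomes differ, so under \<open>Pz\<close>
        the combined rule follows \<open>\<tau>z\<close>. With \<open>p = 1\<close> it may follow
        the wrong rule there, but the term has weight 0.\<close>
      have b': "ennreal b * ennreal (1 - p) \<le> (\<integral>\<^sup>+ \<omega>. ennreal (stopped E \<tau> \<omega>) \<partial>Pz) * ennreal (1 - p)"
      proof (cases "p = 1")
        case True
        then show ?thesis by simp
      next
        case False
        then have "y \<noteq> z" using yz(3) by simp
        then have "(\<integral>\<^sup>+ \<omega>. ennreal (stopped E \<tau> \<omega>) \<partial>Pz) = (\<integral>\<^sup>+ \<omega>. ennreal (stopped E \<tau>z \<omega>) \<partial>Pz)"
          using Pz(2) by (intro nn_integral_cong_AE) (auto elim!: eventually_mono dest: coord simp: stopped_def \<tau>_def)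
        then show ?thesis using b by (simp add: mult_right_mono)
      qed
      have "ennreal (p * a + (1 - p) * b) \<le> ennreal (p * a) + ennreal ((1 - p) * b)"
        by (cases "0 \<le> p * a"; cases "0 \<le> (1 - p) * b")
          (auto simp: ennreal_plus[symmetric] ennreal_neg intro: ennreal_leI simp del: ennreal_plus)
      also have "\<dots> = ennreal a * ennreal p + ennreal b * ennreal (1 - p)"
        using p by (simp add: ennreal_mult'' mult.commute)
      also have "\<dots> \<le> (\<integral>\<^sup>+ \<omega>. ennreal (stopped E \<tau> \<omega>) \<partial>P)"
        using mix[OF measurable_compose[OF stopped_measurable[OF \<tau> E] measurable_ennreal]] a' b' by (simp add: add_mono)
      finally have "ennreal (tree_value E (Suc n) t x w) \<le> (\<integral>\<^sup>+ \<omega>. ennreal (stopped E \<tau> \<omega>) \<partial>P)"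
        unfolding tree .
      moreover have "\<forall>\<omega>\<in>space seqs. t \<le> \<tau> \<omega>" using \<tau>_ge by (auto intro: Suc_leD)
      ultimately show ?thesis using P \<tau> by blast
    qed
  }
qed

lemma attainable_le_one:
  assumes "eprocess Xs \<mu> E" "x \<in> space (prefixes 0)" "attainable E 0 x a"
  shows "a \<le> 1"
proof -
  obtain n w where a: "a = tree_value E n 0 x w" using assms(3) by (auto simp: attainable_def)
  obtain P \<tau> where P: "mean_from 0 P" and \<tau>: "finite_stopping_time Xs \<tau>"
    and le: "ennreal a \<le> (\<integral>\<^sup>+ \<omega>. ennreal (stopped E \<tau> \<omega>) \<partial>P)"
    using tree_value_expectation[of E x 0 n w] assms(1,2) unfolding a eprocess_def by blast
  have "(\<integral>\<^sup>+ \<omega>. ennreal (stopped E \<tau> \<omega>) \<partial>P) \<le> 1"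
    using assms(1) mean_from_0_H_mu[OF P] \<tau> by (simp add: eprocess_def)
  with le have "ennreal a \<le> 1" by (rule order_trans)
  then show ?thesis by simp
qed

section \<open>Borel choice of the bets\<close>

lemma measurable_fun_coord: "(\<lambda>x :: nat \<Rightarrow> real. x i) \<in> borel_measurable borel"
  by (rule measurable_product_coordinates)

text \<open>Inside \<open>nat \<Rightarrow> real\<close> a prefix is a sequence whose entries from
  \<open>t\<close> on are \<open>undefined\<close>, so each coordinate contributes one Borel
  condition.\<close>

lemma space_prefixes_borel: "space (prefixes t) \<in> sets borel"
proof -
  have "space (prefixes t) = (\<Inter>i. if i < t then (\<lambda>x. x i) -` Xs \<inter> space borel else (\<lambda>x. x i) -` {undefined} \<inter> space borel)"
    by (auto simp: space_prefixes PiE_iff extensional_def split: if_splits)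
  moreover have "(\<lambda>x :: nat \<Rightarrow> real. x i) -` Xs \<inter> space borel \<in> sets borel"
      "(\<lambda>x :: nat \<Rightarrow> real. x i) -` {undefined} \<inter> space borel \<in> sets borel" for i
    using measurable_sets[OF measurable_fun_coord Xs_borel] measurable_sets[OF measurable_fun_coord, of "{undefined}"]
    by auto
  ultimately show ?thesis
    by (simp only:) (intro sets.countable_INT'; auto)
qed

text \<open>Separation needs a complete separable metric space, so functions of prefixes are moved
  to all of \<open>nat \<Rightarrow> real\<close>. The map \<open>\<rho>\<close> retracts that space
  onto the prefixes, sending everything else to the all-zero prefix.\<close>

lemma prefix_function_borel:
  assumes g: "g \<in> borel_measurable (prefixes t)"
  shows "(\<lambda>x. if x \<in> space (prefixes t) then g x else 0 :: real) \<in> borel_measurable borel"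
proof -
  define \<rho> where "\<rho> x = (if x \<in> space (prefixes t) then x else (\<lambda>i\<in>{..<t}. 0 :: real))" for x
  have \<rho>_space: "\<rho> x \<in> space (prefixes t)" for x
    using zero_in by (auto simp: \<rho>_def space_prefixes)
  have "(\<lambda>x i. \<rho> x i) \<in> borel \<rightarrow>\<^sub>M prefixes t"
    unfolding prefix_space_def
  proof (rule measurable_PiM_single')
    fix i assume i: "i \<in> {..<t}"
    have "(\<lambda>x. if x \<in> space (prefixes t) then x i else (\<lambda>i\<in>{..<t}. 0 :: real) i) \<in> borel_measurable borel"
      using space_prefixes_borel measurable_fun_coord by (intro measurable_If_set) auto
    also have "(\<lambda>x. if x \<in> space (prefixes t) then x i else (\<lambda>i\<in>{..<t}. 0 :: real) i) = (\<lambda>x. \<rho> x i)"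
      by (simp add: \<rho>_def fun_eq_iff)
    finally have "(\<lambda>x. \<rho> x i) \<in> borel_measurable borel" .
    moreover have "\<rho> x i \<in> Xs" for x using \<rho>_space[of x] i by (auto simp: space_prefixes)
    ultimately show "(\<lambda>x. \<rho> x i) \<in> borel \<rightarrow>\<^sub>M coord_space Xs"
      unfolding coord_space_def by (intro measurable_restrict_space2) auto
  qed (use \<rho>_space in \<open>auto simp: space_prefixes space_coord\<close>)
  then have "\<rho> \<in> borel \<rightarrow>\<^sub>M prefixes t" by simp
  then have "(\<lambda>x. g (\<rho> x)) \<in> borel_measurable borel"
    using g by (rule measurable_compose)
  then have "(\<lambda>x. if x \<in> space (prefixes t) then g (\<rho> x) else 0) \<in> borel_measurable borel"
    using space_prefixes_borel by (intro measurable_If_set) auto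
  also have "(\<lambda>x. if x \<in> space (prefixes t) then g (\<rho> x) else 0) = (\<lambda>x. if x \<in> space (prefixes t) then g x else 0)"
    by (auto simp: \<rho>_def fun_eq_iff)
  finally show ?thesis .
qed

text \<open>The way back: entries from \<open>t\<close> on are constant on prefixes, so the
  inclusion into \<open>nat \<Rightarrow> real\<close> is measurable and the separating sets can be
  used on the prefix space.\<close>

lemma borel_set_prefixes:
  assumes "C \<in> sets borel"
  shows "C \<inter> space (prefixes t) \<in> sets (prefixes t)"
proof -
  have "(\<lambda>x. x i) \<in> borel_measurable (prefixes t)" for i
  proof (cases "i < t")
    case True
    then show ?thesis by (rule measurable_coord_prefixes)
  next
    case False
    then have "x i = undefined" if "x \<in> space (prefixes t)" for x
      using that by (auto simp: space_prefixes PiE_iff extensional_def)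
    then show ?thesis by (subst measurable_cong[where g = "\<lambda>_. undefined"]) auto
  qed
  then have "(\<lambda>x i. x i) \<in> prefixes t \<rightarrow>\<^sub>M PiM UNIV (\<lambda>_. borel :: real measure)"
    by (intro measurable_PiM_single') auto
  then have "(\<lambda>x. x) \<in> prefixes t \<rightarrow>\<^sub>M (borel :: (nat \<Rightarrow> real) measure)"
    using sets_PiM_equal_borel measurable_cong_sets by blast
  then have "(\<lambda>x. x) -` C \<inter> space (prefixes t) \<in> sets (prefixes t)"
    using assms by (rule measurable_sets)
  then show ?thesis by simp
qed

lemma snd_coord_continuous: "continuous_on UNIV (\<lambda>p :: (nat \<Rightarrow> real) \<times> (nat \<Rightarrow> real). snd p k)"
  by (rule continuous_on_product_then_coordinatewise[OF continuous_on_snd[OF continuous_on_id]])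

lemma fst_coord_continuous: "continuous_on UNIV (\<lambda>p :: (nat \<Rightarrow> real) \<times> (nat \<Rightarrow> real). fst p k)"
  by (rule continuous_on_product_then_coordinatewise[OF continuous_on_fst[OF continuous_on_id]])

lemma extend_measurable:
  "(\<lambda>p :: (nat \<Rightarrow> real) \<times> (nat \<Rightarrow> real). ((fst p)(t := snd p k), \<lambda>j :: nat. snd p (h j))) \<in> borel \<rightarrow>\<^sub>M borel"
proof (intro borel_measurable_continuous_onI continuous_on_Pair continuous_on_coordinatewise_then_product)
  fix i
  show "continuous_on UNIV (\<lambda>p :: (nat \<Rightarrow> real) \<times> (nat \<Rightarrow> real). ((fst p)(t := snd p k)) i)"
    using snd_coord_continuous fst_coord_continuous by (cases "i = t") auto
  show "continuous_on UNIV (\<lambda>p :: (nat \<Rightarrow> real) \<times> (nat \<Rightarrow> real). snd p (h i))"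
    by (rule snd_coord_continuous)
qed

lemma snd_coord_measurable [measurable]: "(\<lambda>p :: (nat \<Rightarrow> real) \<times> (nat \<Rightarrow> real). snd p k) \<in> borel_measurable borel"
  by (rule borel_measurable_continuous_onI) (rule snd_coord_continuous)

lemma fst_measurable_borel: "(fst :: (nat \<Rightarrow> real) \<times> (nat \<Rightarrow> real) \<Rightarrow> _) \<in> borel \<rightarrow>\<^sub>M borel"
  by (intro borel_measurable_continuous_onI continuous_intros)

definition prefix_tree_value :: "(nat \<Rightarrow> (nat \<Rightarrow> real) \<Rightarrow> real) \<Rightarrow> nat \<Rightarrow> nat \<Rightarrow> (nat \<Rightarrow> real) \<times> (nat \<Rightarrow> real) \<Rightarrow> real" where
  "prefix_tree_value E n t p = (if fst p \<in> space (prefixes t) then tree_value E n t (fst p) (snd p) else 0)"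

lemma prefix_tree_value_measurable:
  assumes E: "\<And>t. E t \<in> borel_measurable (prefixes t)"
  shows "prefix_tree_value E n t \<in> borel_measurable borel"
proof (induction n arbitrary: t)
  case 0
  show ?case
    using measurable_compose[OF fst_measurable_borel prefix_function_borel[OF E]]
    unfolding prefix_tree_value_def[abs_def] tree_value.simps(1) .
next
  case (Suc n)
  define F :: "(nat \<Rightarrow> real) \<times> (nat \<Rightarrow> real) \<Rightarrow> real" where
    "F p = snd p 0 * prefix_tree_value E n (Suc t) ((fst p)(t := snd p 1), \<lambda>k. snd p (2 * k + 3)) +
     (1 - snd p 0) * prefix_tree_value E n (Suc t) ((fst p)(t := snd p 2), \<lambda>k. snd p (2 * k + 4))" for p
  define G :: "(nat \<Rightarrow> real) \<times> (nat \<Rightarrow> real) \<Rightarrow> real" where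
    "G p = (if fst p \<in> space (prefixes t) then E t (fst p) else 0)" for p
  define D :: "((nat \<Rightarrow> real) \<times> (nat \<Rightarrow> real)) set" where "D = {p. fst p \<in> space (prefixes t) \<and> two_point (snd p 0) (snd p 1) (snd p 2)}"
  have "F \<in> borel_measurable borel"
    unfolding F_def
    by (intro borel_measurable_add borel_measurable_times borel_measurable_diff borel_measurable_const
        snd_coord_measurable measurable_compose[OF extend_measurable Suc.IH])
  moreover have "G \<in> borel_measurable borel"
    unfolding G_def by (rule measurable_compose[OF fst_measurable_borel prefix_function_borel[OF E]])
  moreover have "D \<in> sets borel"
  proof -
    note [measurable] = Xs_borel
    have "{p \<in> space borel. two_point (snd p 0) (snd p 1) (snd p 2)} \<in> sets (borel :: ((nat \<Rightarrow> real) \<times> (nat \<Rightarrow> real)) measure)" (is "?A \<in> _")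
      unfolding two_point_def by measurable
    moreover have "fst -` space (prefixes t) \<inter> space borel \<in> sets (borel :: ((nat \<Rightarrow> real) \<times> (nat \<Rightarrow> real)) measure)"
      using fst_measurable_borel space_prefixes_borel by (rule measurable_sets)
    moreover have "D = ?A \<inter> (fst -` space (prefixes t) \<inter> space borel)"
      by (auto simp: D_def)
    ultimately show ?thesis by (simp only: sets.Int)
  qed
  ultimately have "(\<lambda>p. if p \<in> D then F p else G p) \<in> borel_measurable borel"
    by (intro measurable_If_set) auto
  also have "(\<lambda>p. if p \<in> D then F p else G p) = prefix_tree_value E (Suc n) t"
  proof (rule ext)
    fix p
    show "(if p \<in> D then F p else G p) = prefix_tree_value E (Suc n) t p"
    proof (cases "p \<in> D")
      case True
      then have "(fst p)(t := snd p 1) \<in> space (prefixes (Suc t))" "(fst p)(t := snd p 2) \<in> space (prefixes (Suc t))"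
        by (auto simp: D_def two_point_def intro!: prefix_extend)
      then show ?thesis using True by (simp add: F_def D_def prefix_tree_value_def)
    next
      case False
      then show ?thesis by (auto simp: G_def D_def prefix_tree_value_def)
    qed
  qed
  finally show ?case .
qed

text \<open>The admissible slopes at a prefix x form the interval between the supremum over outcomes above
  the mean and the infimum over outcomes below it of quotients of attainable values. These bounds are
  only analytic in x, so a Borel choice between them needs the separation theorem.\<close>
lemma bet_exists:
  assumes E: "\<And>t. E t \<in> borel_measurable (prefixes t)" "\<And>t x. x \<in> space (prefixes t) \<Longrightarrow> 0 \<le> E t x"
    and L: "L \<in> borel_measurable (prefixes t)"
    and dom: "\<And>x a. x \<in> space (prefixes t) \<Longrightarrow> attainable E t x a \<Longrightarrow> a \<le> L x"
  shows "\<exists>l\<in>borel_measurable (prefixes t). (\<forall>x\<in>space (prefixes t). l x \<in> I_mu \<mu>) \<and>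
    (\<forall>x\<in>space (prefixes t). \<forall>y\<in>Xs. \<forall>a. attainable E (Suc t) (x(t := y)) a \<longrightarrow> a \<le> L x * (1 + l x * (y - \<mu>)))"
proof -
  define Lb where "Lb x = (if x \<in> space (prefixes t) then L x else 0)" for x
  have Lb: "Lb \<in> borel_measurable borel" unfolding Lb_def by (rule prefix_function_borel[OF L])
  have L_nonneg: "0 \<le> L x" if "x \<in> space (prefixes t)" for x
    using dom[OF that attainable_stop] E(2)[OF that] by linarith
  \<comment> \<open>In \<open>w = snd p\<close>, entry 0 is the next outcome and the rest codes a
    tree after it. The projection of \<open>over Y c\<close> consists of the prefixes where the line
    with bet \<open>c\<close> is exceeded at an outcome in \<open>Y\<close>: the bet is too small if
    \<open>Y\<close> lies above \<mu>, too large if below.\<close>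
  define over where "over Y c = {p :: (nat \<Rightarrow> real) \<times> (nat \<Rightarrow> real). fst p \<in> space (prefixes t) \<and> snd p 0 \<in> Xs \<inter> Y \<and>
    (\<exists>n. Lb (fst p) * (1 + c * (snd p 0 - \<mu>)) < prefix_tree_value E n (Suc t) ((fst p)(t := snd p 0), \<lambda>k. snd p (Suc k)))}" for Y c
  have over_borel: "over Y c \<in> sets borel" if "Y \<in> sets borel" for Y and c :: real
  proof -
    note [measurable] = Xs_borel that measurable_compose[OF fst_measurable_borel Lb]
      measurable_compose[OF extend_measurable prefix_tree_value_measurable[OF E(1)]]
    have "{p \<in> space borel. snd p 0 \<in> Xs \<inter> Y \<and>
      (\<exists>n. Lb (fst p) * (1 + c * (snd p 0 - \<mu>)) < prefix_tree_value E n (Suc t) ((fst p)(t := snd p 0), \<lambda>k. snd p (Suc k)))}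
      \<in> sets (borel :: ((nat \<Rightarrow> real) \<times> (nat \<Rightarrow> real)) measure)" (is "?A \<in> _")
      by measurable
    moreover have "fst -` space (prefixes t) \<inter> space borel \<in> sets (borel :: ((nat \<Rightarrow> real) \<times> (nat \<Rightarrow> real)) measure)"
      using fst_measurable_borel space_prefixes_borel by (rule measurable_sets)
    moreover have "over Y c = ?A \<inter> (fst -` space (prefixes t) \<inter> space borel)"
      by (auto simp: over_def)
    ultimately show ?thesis by (simp only: sets.Int)
  qed
  have in_over: "x \<in> fst ` over Y c \<longleftrightarrow> x \<in> space (prefixes t) \<and>
      (\<exists>y\<in>Xs \<inter> Y. \<exists>a. attainable E (Suc t) (x(t := y)) a \<and> L x * (1 + c * (y - \<mu>)) < a)" for x Y c
  proof (intro iffI)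
    assume "x \<in> fst ` over Y c"
    then obtain w n where w: "x \<in> space (prefixes t)" "w 0 \<in> Xs \<inter> Y"
      "Lb x * (1 + c * (w 0 - \<mu>)) < prefix_tree_value E n (Suc t) (x(t := w 0), \<lambda>k. w (Suc k))"
      by (auto simp: over_def)
    then have "x(t := w 0) \<in> space (prefixes (Suc t))" by (auto intro: prefix_extend)
    then have "L x * (1 + c * (w 0 - \<mu>)) < tree_value E n (Suc t) (x(t := w 0)) (\<lambda>k. w (Suc k))"
      using w by (simp add: Lb_def prefix_tree_value_def)
    then show "x \<in> space (prefixes t) \<and> (\<exists>y\<in>Xs \<inter> Y. \<exists>a. attainable E (Suc t) (x(t := y)) a \<and> L x * (1 + c * (y - \<mu>)) < a)"
      using w unfolding attainable_def by blast
  next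
    assume r: "x \<in> space (prefixes t) \<and> (\<exists>y\<in>Xs \<inter> Y. \<exists>a. attainable E (Suc t) (x(t := y)) a \<and> L x * (1 + c * (y - \<mu>)) < a)"
    then obtain y n w where y: "y \<in> Xs \<inter> Y" "L x * (1 + c * (y - \<mu>)) < tree_value E n (Suc t) (x(t := y)) w"
      unfolding attainable_def by blast
    have "x(t := y) \<in> space (prefixes (Suc t))" using r y(1) by (auto intro: prefix_extend)
    then have "(x, case_nat y w) \<in> over Y c"
      using r y unfolding over_def by (auto simp: Lb_def prefix_tree_value_def intro!: exI[of _ n])
    then show "x \<in> fst ` over Y c" by force
  qed
  \<comment> \<open>Violations on both sides of \<mu> would mix to a value attainable at
    \<open>x\<close> that exceeds the height of the line at \<mu>, which is
    \<open>L x\<close>.\<close>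
  have "fst ` over {\<mu><..} c \<inter> fst ` over {..<\<mu>} c = {}" for c
  proof (intro equals0I)
    fix x assume "x \<in> fst ` over {\<mu><..} c \<inter> fst ` over {..<\<mu>} c"
    then obtain y a z b where x: "x \<in> space (prefixes t)"
      and y: "y \<in> Xs" "\<mu> < y" "attainable E (Suc t) (x(t := y)) a" "L x * (1 + c * (y - \<mu>)) < a"
      and z: "z \<in> Xs" "z < \<mu>" "attainable E (Suc t) (x(t := z)) b" "L x * (1 + c * (z - \<mu>)) < b"
      unfolding Int_iff in_over by auto
    define p where "p = (\<mu> - z) / (y - z)"
    have "0 < p" "0 < 1 - p" "p * (y - z) = \<mu> - z" using y(2) z(2) by (auto simp: p_def field_simps)
    then have p: "0 < p" "0 < 1 - p" "p * y + (1 - p) * z = \<mu>" by (simp_all add: algebra_simps)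
    have "two_point p y z" using p y z by (auto simp: two_point_def)
    then have "p * a + (1 - p) * b \<le> L x"
      using attainable_two_point[OF _ y(3) z(3)] dom[OF x] by blast
    moreover have "p * (L x * (1 + c * (y - \<mu>))) + (1 - p) * (L x * (1 + c * (z - \<mu>))) < p * a + (1 - p) * b"
      using y(4) z(4) p by (intro add_strict_mono mult_strict_left_mono)
    moreover have "p * (L x * (1 + c * (y - \<mu>))) + (1 - p) * (L x * (1 + c * (z - \<mu>)))
        = L x * (1 + c * ((p * y + (1 - p) * z) - \<mu>))"
      by (simp add: algebra_simps)
    ultimately show False using p(3) by simp
  qed
  then have "\<exists>C\<in>sets borel. fst ` over {\<mu><..} c \<subseteq> C \<and> C \<inter> fst ` over {..<\<mu>} c = {}" for c
    using lusin_separation[OF over_borel over_borel] unfolding borel_separable_def by simp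
  \<comment> \<open>\<open>C c\<close> holds every prefix where \<open>c\<close> is too small and
    none where it is too large; membership of the other prefixes is arbitrary.\<close>
  then obtain C where C: "\<And>c. C c \<in> sets borel" "\<And>c. fst ` over {\<mu><..} c \<subseteq> C c"
      "\<And>c. C c \<inter> fst ` over {..<\<mu>} c = {}"
    by metis
  define lo where "lo = 1 / (\<mu> - 1)"
  define up where "up = 1 / \<mu>"
  have lo_up: "lo < 0" "0 < up" using mu_pos mu_less by (auto simp: lo_def up_def field_simps)
  define D where "D = \<rat> \<inter> {lo..up}"
  have D: "countable D" "0 \<in> D" "\<And>c. c \<in> D \<Longrightarrow> lo \<le> c \<and> c \<le> up"
    using lo_up countable_rat by (auto simp: D_def)
  \<comment> \<open>The bet is the supremum of the rational \<open>c\<close> with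
    \<open>x \<in> C c\<close>. The filler \<open>lo\<close> keeps it in range when there are none,
    and countability of \<open>D\<close> keeps it Borel. The sets \<open>C c\<close> need not be
    monotone in \<open>c\<close>.\<close>
  define g where "g x c = (if x \<in> C c then c else lo)" for x c
  define l where "l x = (SUP c\<in>D. g x c)" for x
  have g_le: "g x c \<le> up" if "c \<in> D" for x c using D(3)[OF that] lo_up by (auto simp: g_def)
  have bdd: "bdd_above (g x ` D)" for x
    using g_le by (auto intro!: bdd_aboveI2)
  have l_measurable: "l \<in> borel_measurable (prefixes t)"
    unfolding l_def
  proof (rule borel_measurable_cSUP[OF D(1) _ bdd])
    fix c
    have "(\<lambda>x. if x \<in> C c then c else lo) \<in> borel_measurable (prefixes t)"
      using borel_set_prefixes[OF C(1)] by (intro measurable_If_set) auto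
    then show "(\<lambda>x. g x c) \<in> borel_measurable (prefixes t)" by (simp add: g_def)
  qed
  have l_range: "lo \<le> l x" "l x \<le> up" for x
  proof -
    have "lo \<le> g x 0" using lo_up by (simp add: g_def)
    also have "\<dots> \<le> l x" unfolding l_def by (rule cSUP_upper[OF D(2) bdd])
    finally show "lo \<le> l x" .
    show "l x \<le> up" unfolding l_def using D(2) g_le by (intro cSUP_least) auto
  qed
  have bound: "a \<le> L x * (1 + l x * (y - \<mu>))"
    if x: "x \<in> space (prefixes t)" and y: "y \<in> Xs" and a: "attainable E (Suc t) (x(t := y)) a" for x y a
  proof (rule ccontr)
    assume "\<not> a \<le> L x * (1 + l x * (y - \<mu>))"
    then have gap: "0 < a - L x * (1 + l x * (y - \<mu>))" by simp
    \<comment> \<open>\<open>\<delta>\<close> is chosen so that changing the bet by at most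
      \<open>\<delta>\<close> moves the line at \<open>y\<close> by less than the gap;
      \<open>K + 1\<close> avoids division by zero.\<close>
    define K where "K = L x * \<bar>y - \<mu>\<bar>"
    define \<delta> where "\<delta> = (a - L x * (1 + l x * (y - \<mu>))) / (K + 1)"
    have K: "0 \<le> K" using L_nonneg[OF x] by (simp add: K_def)
    then have \<delta>: "0 < \<delta>" using gap by (simp add: \<delta>_def)
    have "\<delta> * (K + 1) = a - L x * (1 + l x * (y - \<mu>))" using K by (simp add: \<delta>_def)
    then have \<delta>K: "\<delta> * K < a - L x * (1 + l x * (y - \<mu>))" using \<delta> by (simp add: algebra_simps)
    have move: "L x * (1 + c * (y - \<mu>)) < a" if "\<bar>c - l x\<bar> \<le> \<delta>" for c
    proof -
      have "L x * (1 + c * (y - \<mu>)) - L x * (1 + l x * (y - \<mu>)) = L x * ((c - l x) * (y - \<mu>))"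
        by (simp add: algebra_simps)
      also have "\<dots> \<le> L x * (\<bar>c - l x\<bar> * \<bar>y - \<mu>\<bar>)"
        using L_nonneg[OF x] by (intro mult_left_mono) (simp_all flip: abs_mult)
      also have "\<dots> = \<bar>c - l x\<bar> * K" by (simp add: K_def)
      also have "\<dots> \<le> \<delta> * K" using that K by (rule mult_right_mono)
      finally show ?thesis using \<delta>K by linarith
    qed
    have stop: "0 \<le> E (Suc t) (x(t := u))" if "u \<in> Xs" for u
      using E(2)[OF prefix_extend[OF x that]] .
    consider "\<mu> < y" "l x < up" | "\<mu> < y" "l x = up" | "y < \<mu>" "lo < l x" | "y < \<mu>" "l x = lo" | "y = \<mu>"
      using l_range[of x] by linarith
    then show False
    proof cases
      case 1
      then obtain c where c: "c \<in> \<rat>" "l x < c" "c < min up (l x + \<delta>)"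
        using Rats_dense_in_real[of "l x" "min up (l x + \<delta>)"] \<delta> by auto
      then have cD: "c \<in> D" using l_range[of x] by (auto simp: D_def)
      have "L x * (1 + c * (y - \<mu>)) < a" using c by (intro move) auto
      then have "x \<in> fst ` over {\<mu><..} c" unfolding in_over using x y a 1 by auto
      then have "g x c = c" using C(2) by (auto simp: g_def)
      then have "c \<le> l x" unfolding l_def using cSUP_upper[OF cD bdd, of x] by simp
      then show False using c by simp
    next
      case 2
      \<comment> \<open>The line with the largest bet vanishes at 0, and \<open>E\<close> is
        nonnegative there. Mixing \<open>y\<close> with 0 gives \<open>p * a \<le> L x\<close>,
        which is exactly the bound, as this \<open>p\<close> is the reciprocal of the factor at
        \<open>y\<close>.\<close>
      define p where "p = \<mu> / y"
      have p: "0 < p" "p < 1" "p * y = \<mu>" using 2 mu_pos by (auto simp: p_def)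
      then have "two_point p y 0" using y zero_in 2 mu_pos by (auto simp: two_point_def)
      then have "p * a + (1 - p) * E (Suc t) (x(t := 0)) \<le> L x"
        using attainable_two_point[OF _ a attainable_stop] dom[OF x] by blast
      moreover have "0 \<le> (1 - p) * E (Suc t) (x(t := 0))" using p stop[OF zero_in] by simp
      ultimately have "p * a \<le> L x" by linarith
      moreover have "p * (1 + up * (y - \<mu>)) = 1" using 2 mu_pos by (simp add: p_def up_def field_simps)
      then have "p * (L x * (1 + l x * (y - \<mu>))) = L x" using 2 by (metis mult.left_commute mult.right_neutral)
      ultimately have "p * a \<le> p * (L x * (1 + l x * (y - \<mu>)))" by (simp only:)
      then show False using p gap by simp
    next
      case 3
      \<comment> \<open>Because \<open>c'\<close> is at least \<open>lo\<close>, any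
        \<open>g x c\<close> above it is not the filler, so \<open>x \<in> C c\<close>. Such a
        \<open>c\<close> would then be too large at \<open>y\<close>, which \<open>C c\<close>
        excludes.\<close>
      define c' where "c' = max lo (l x - \<delta>)"
      have c': "c' < l x" "lo \<le> c'" "\<bar>c' - l x\<bar> \<le> \<delta>" using 3 \<delta> l_range[of x] by (auto simp: c'_def)
      have "\<exists>c\<in>D. c' < g x c"
        using c'(1) D(2) bdd unfolding l_def by (subst (asm) less_cSUP_iff) auto
      then obtain c where c: "c \<in> D" "c' < g x c" by blast
      then have xc: "x \<in> C c" "c' < c" using c'(2) by (auto simp: g_def split: if_splits)
      have "c * (y - \<mu>) \<le> c' * (y - \<mu>)" using xc 3 by (intro mult_right_mono_neg) auto
      then have "L x * (1 + c * (y - \<mu>)) \<le> L x * (1 + c' * (y - \<mu>))"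
        using L_nonneg[OF x] by (intro mult_left_mono) auto
      also have "\<dots> < a" by (rule move[OF c'(3)])
      finally have "x \<in> fst ` over {..<\<mu>} c" unfolding in_over using x y a 3 by auto
      then show False using C(3) xc by blast
    next
      case 4
      \<comment> \<open>The mirror image: the line with the smallest bet vanishes at 1, so
        \<open>y\<close> is mixed with 1.\<close>
      define p where "p = (1 - \<mu>) / (1 - y)"
      have "0 < p" "p < 1" "p * (1 - y) = 1 - \<mu>"
        using 4 mu_less by (auto simp: p_def)
      then have p: "0 < p" "p < 1" "p * y + (1 - p) * 1 = \<mu>" by (simp_all add: algebra_simps)
      then have "two_point p y 1" using y one_in 4 mu_less by (auto simp: two_point_def)
      then have "p * a + (1 - p) * E (Suc t) (x(t := 1)) \<le> L x"
        using attainable_two_point[OF _ a attainable_stop] dom[OF x] by blast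
      moreover have "0 \<le> (1 - p) * E (Suc t) (x(t := 1))" using p stop[OF one_in] by simp
      ultimately have "p * a \<le> L x" by linarith
      moreover have "1 + lo * (y - \<mu>) = (1 - y) / (1 - \<mu>)"
        using mu_less by (simp add: lo_def divide_simps) (simp add: algebra_simps)
      then have "p * (1 + lo * (y - \<mu>)) = 1" using 4 mu_less by (simp add: p_def)
      then have "p * (L x * (1 + l x * (y - \<mu>))) = L x" using 4 by (metis mult.left_commute mult.right_neutral)
      ultimately have "p * a \<le> p * (L x * (1 + l x * (y - \<mu>)))" by (simp only:)
      then show False using p gap by simp
    next
      \<comment> \<open>Here no bet has any effect. The degenerate experiment with sure outcome
        \<mu> makes \<open>a\<close> attainable already at \<open>x\<close>.\<close>
      case 5
      then have "two_point 1 y y" using y by (auto simp: two_point_def)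
      from attainable_two_point[OF this a a] have "attainable E t x a" by simp
      then have "a \<le> L x" by (rule dom[OF x])
      then show False using gap 5 by simp
    qed
  qed
  show ?thesis
  proof (intro bexI conjI ballI allI impI)
    show "l \<in> borel_measurable (prefixes t)" by (rule l_measurable)
    show "l x \<in> I_mu \<mu>" for x using l_range[of x] by (simp add: I_mu_def lo_def up_def)
  qed (rule bound)
qed

text \<open>Domination of \<open>E\<close> alone would not survive the induction over time. The
  invariant is that the wealth dominates every attainable value; stopping at once then yields
  \<open>E\<close> itself.\<close>

lemma cb_class_majorising:
  assumes "eprocess Xs \<mu> E"
  shows "\<exists>lam\<in>Lambda_mu Xs \<mu>. majorises Xs (cb_process \<mu> lam) E"
proof -
  have E: "E t \<in> borel_measurable (prefixes t)" "x \<in> space (prefixes t) \<Longrightarrow> 0 \<le> E t x" for t x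
    using assms by (auto simp: eprocess_def)
  \<comment> \<open>Domination is a premise inside \<open>good\<close>, so a good bet exists for
    every Borel \<open>L\<close>, with 0 as fallback. The recursion and its measurability can thus
    be settled before domination is proved.\<close>
  define good where "good t L l \<longleftrightarrow> l \<in> borel_measurable (prefixes t) \<and> (\<forall>x\<in>space (prefixes t). l x \<in> I_mu \<mu>) \<and>
    ((\<forall>x\<in>space (prefixes t). \<forall>a. attainable E t x a \<longrightarrow> a \<le> L x) \<longrightarrow>
     (\<forall>x\<in>space (prefixes t). \<forall>y\<in>Xs. \<forall>a. attainable E (Suc t) (x(t := y)) a \<longrightarrow> a \<le> L x * (1 + l x * (y - \<mu>))))"
    for t and L l :: "(nat \<Rightarrow> real) \<Rightarrow> real"
  have good_exists: "\<exists>l. good t L l" if "L \<in> borel_measurable (prefixes t)" for t L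
  proof (cases "\<forall>x\<in>space (prefixes t). \<forall>a. attainable E t x a \<longrightarrow> a \<le> L x")
    case True
    then show ?thesis using bet_exists[OF E that] unfolding good_def by blast
  next
    case False
    have "0 \<in> I_mu \<mu>" using mu_pos mu_less by (auto simp: I_mu_def field_simps)
    then have "good t L (\<lambda>_. 0)" using False unfolding good_def by auto
    then show ?thesis by blast
  qed
  define bet where "bet t L = (SOME l. good t L l)" for t L
  \<comment> \<open>Each bet depends on the wealth function reached so far, and that wealth on the
    earlier bets. The recursion runs over the wealth functions, and the strategy is read off
    afterwards.\<close>
  define W where "W = rec_nat (\<lambda>_ :: nat \<Rightarrow> real. 1 :: real)
    (\<lambda>t L x. L (restrict x {..<t}) * (1 + bet t L (restrict x {..<t}) * (x t - \<mu>)))"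
  define lam where "lam t = bet t (W t)" for t
  have W_0: "W 0 = (\<lambda>_. 1)" by (simp add: W_def)
  have W_Suc: "W (Suc t) = (\<lambda>x. W t (restrict x {..<t}) * (1 + lam t (restrict x {..<t}) * (x t - \<mu>)))" for t
    by (simp add: W_def lam_def)
  have good: "good t (W t) (lam t)" if "W t \<in> borel_measurable (prefixes t)" for t
    unfolding lam_def bet_def using good_exists[OF that] by (rule someI_ex)
  have W_meas: "W t \<in> borel_measurable (prefixes t)" for t
  proof (induction t)
    case 0
    show ?case by (simp add: W_0)
  next
    case (Suc t)
    have "lam t \<in> borel_measurable (prefixes t)" using good[OF Suc.IH] by (simp add: good_def)
    then have "(\<lambda>x. lam t (restrict x {..<t})) \<in> borel_measurable (prefixes (Suc t))"
      by (rule measurable_compose[OF measurable_prefix_prefix[OF le_SucI[OF order_refl]]])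
    moreover have "(\<lambda>x. W t (restrict x {..<t})) \<in> borel_measurable (prefixes (Suc t))"
      using Suc.IH by (rule measurable_compose[OF measurable_prefix_prefix[OF le_SucI[OF order_refl]]])
    moreover have "(\<lambda>x. x t) \<in> borel_measurable (prefixes (Suc t))"
      by (rule measurable_coord_prefixes) simp
    ultimately show ?case
      unfolding W_Suc
      by (intro borel_measurable_add borel_measurable_times borel_measurable_diff borel_measurable_const)
  qed
  have lam: "lam \<in> Lambda_mu Xs \<mu>"
    using good[OF W_meas] by (auto simp: Lambda_mu_def good_def)
  have W_cb: "W t = cb_process \<mu> lam t" for t
  proof (induction t)
    case 0
    show ?case by (simp add: W_0 cb_process_def fun_eq_iff)
  next
    case (Suc t)
    show ?case unfolding W_Suc Suc.IH cb_process_restrict by (simp add: cb_process_def fun_eq_iff)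
  qed
  have dom: "a \<le> W t x" if "x \<in> space (prefixes t)" "attainable E t x a" for t x a
    using that
  proof (induction t arbitrary: x a)
    case 0
    then show ?case using attainable_le_one[OF assms] by (simp add: W_0)
  next
    case (Suc t)
    define p where "p = restrict x {..<t}"
    have p: "p \<in> space (prefixes t)" using Suc.prems(1) by (auto simp: p_def intro: prefix_prefix_in_space)
    have x: "x = p(t := x t)"
      using Suc.prems(1) by (auto simp: p_def space_prefixes PiE_iff extensional_def fun_eq_iff restrict_def less_Suc_eq)
    have "x t \<in> Xs" using Suc.prems(1) by (auto simp: space_prefixes)
    moreover have "attainable E (Suc t) (p(t := x t)) a" using Suc.prems(2) x by simp
    ultimately show ?case
      using good[OF W_meas, of t] Suc.IH p unfolding good_def W_Suc p_def by blast
  qed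
  then have "majorises Xs (cb_process \<mu> lam) E"
    using attainable_stop by (auto simp: majorises_def W_cb)
  then show ?thesis using lam by blast
qed

text \<open>Maximality follows from majorisation and rigidity: an e-process above a betting process
  lies below another betting process, which must coincide with the first.\<close>

lemma cb_class_optimal: "optimal_class Xs \<mu> (cb_class Xs \<mu>)"
  unfolding optimal_class_def
proof (intro conjI ballI)
  show "eprocess Xs \<mu> E" if "E \<in> cb_class Xs \<mu>" for E
    using that cb_process_eprocess by (auto simp: cb_class_def)
  show "majorising_class Xs \<mu> (cb_class Xs \<mu>)"
    using cb_class_majorising by (auto simp: majorising_class_def cb_class_def)
  fix E assume "E \<in> cb_class Xs \<mu>"
  then obtain lam where lam: "lam \<in> Lambda_mu Xs \<mu>" and E: "E = cb_process \<mu> lam"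
    by (auto simp: cb_class_def)
  show "maximal_eprocess Xs \<mu> E"
    unfolding maximal_eprocess_def
  proof (intro conjI notI)
    show "eprocess Xs \<mu> E" using cb_process_eprocess[OF lam] E by simp
    assume "\<exists>E'. eprocess Xs \<mu> E' \<and> strictly_majorises Xs E' E"
    then obtain E' where E': "eprocess Xs \<mu> E'" "majorises Xs E' E" "\<not> majorises Xs E E'"
      by (auto simp: strictly_majorises_def)
    obtain lam' where lam': "lam' \<in> Lambda_mu Xs \<mu>" "majorises Xs (cb_process \<mu> lam') E'"
      using cb_class_majorising[OF E'(1)] by blast
    have "majorises Xs (cb_process \<mu> lam') (cb_process \<mu> lam)"
      using lam'(2) E'(2) unfolding E majorises_def by (meson order_trans)
    then have "majorises Xs E E'"
      using cb_process_majorises_eq[OF lam lam'(1)] lam'(2) unfolding E majorises_def by simp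
    then show False using E'(3) by simp
  qed
qed

end

theorem theorem3:
  fixes Xs :: "real set" and \<mu> :: real
  assumes "Xs \<in> sets borel" and "Xs \<subseteq> {0..1}" and "0 \<in> Xs" and "1 \<in> Xs"
    and "0 < \<mu>" and "\<mu> < 1"
  shows "optimal_class Xs \<mu> (cb_class Xs \<mu>)"
proof -
  interpret bounded_mean Xs \<mu> using assms by unfold_locales
  show ?thesis by (rule cb_class_optimal)
qed

end
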